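(* Let $K$ be an algebraically closed field of characteristic $0$. Let $a=2$ and let $b\ge 2$ be an integer relatively prime to $a$. Suppose $F,G\in K[x,y]$ satisfy: (1) $[F,G]\in K$; and (2) $\{(1,0),(0,1),(0,0)\}\subset N(F)\cap N(G)$ and $N(F)$ is similar to $N(G)$ with the origin as center of similarity and with ratio $\deg(F):\deg(G)=a:b$. Suppose further that each edge of $\frac1a N(F)$ contains either the origin or no lattice points other than its endpoints. Then $[F,G]=0$.
   Context: $[f,g]=\frac{\partial f}{\partial x}\frac{\partial g}{\partial y}-\frac{\partial g}{\partial x}\frac{\partial f}{\partial y}$. For $f=\sum f_{ij}x^iy^j$, the Newton polygon $N(f)$ is the convex hull in $\mathbb{R}^2$ of $\mathrm{supp}(f)=\{(i,j): f_{ij}\ne0\}$. For a real number $r$ and $S\subseteq\mathbb{R}^2$, $rS=\{rs: s\in S\}$. Lattice points are points of $\mathbb{Z}^2$. *)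

theory Defs
  imports
    "HOL-Analysis.Analysis"
    "HOL-Computational_Algebra.Computational_Algebra"
begin

text \<open>
  A polynomial $f = \sum f_{ij} x^i y^j$ in \<open>K[x,y]\<close> is an element of \<open>K[x][y]\<close>: the outer
  variable of \<open>'a poly poly\<close> is \<open>y\<close> and the inner one is \<open>x\<close>.
\<close>

definition bicoeff :: "'a::zero poly poly \<Rightarrow> nat \<Rightarrow> nat \<Rightarrow> 'a" where
  "bicoeff f i j = coeff (coeff f j) i"

definition pderiv_x :: "'a::field poly poly \<Rightarrow> 'a poly poly" where
  "pderiv_x f = map_poly pderiv f"

definition pderiv_y :: "'a::field poly poly \<Rightarrow> 'a poly poly" where
  "pderiv_y f = pderiv f"

definition jacobian_bracket :: "'a::field poly poly \<Rightarrow> 'a poly poly \<Rightarrow> 'a poly poly" where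
  "jacobian_bracket f g = pderiv_x f * pderiv_y g - pderiv_x g * pderiv_y f"

definition supp :: "'a::zero poly poly \<Rightarrow> (nat \<times> nat) set" where
  "supp f = {(i, j). bicoeff f i j \<noteq> 0}"

text \<open>The total degree; since \<open>Sup {} = 0\<close> on \<open>nat\<close>, the zero polynomial gets degree 0.\<close>

definition total_degree :: "'a::zero poly poly \<Rightarrow> nat" where
  "total_degree f = Sup ((\<lambda>(i, j). i + j) ` supp f)"

definition newton_polygon :: "'a::zero poly poly \<Rightarrow> (real \<times> real) set" where
  "newton_polygon f = convex hull ((\<lambda>(i, j). (real i, real j)) ` supp f)"

definition scale_set :: "real \<Rightarrow> (real \<times> real) set \<Rightarrow> (real \<times> real) set" where
  "scale_set r S = (\<lambda>s. r *\<^sub>R s) ` S"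

definition lattice_points :: "(real \<times> real) set" where
  "lattice_points = \<int> \<times> \<int>"

end

theory Submission
  imports Defs
begin

text \<open>
  Put $P = \frac12 N(F) = \frac1b N(G)$, a lattice polygon, and let $[v, v']$ be the edge through
  which the ray spanned by $(1,1)$ leaves \<open>P\<close>; it misses the origin, so $m = v' - v$ is primitive.
  Grade by $\mathrm{wt}(p) = \det(p, m)$ and put $D = \det(v, v') = \mathrm{wt}(v)$. Since the bracket of the leading
  forms of \<open>F\<close> and \<open>G\<close> vanishes, \<open>b\<close> is odd and the edge carries no further lattice points,
  these forms are multiples of $H^2$ and $H^b$ for one binomial $H = x^v (z - \rho)$ with $z = x^m$.

  Let $[F,G] = c \ne 0$. Starting with $Q = G^2$, subtract multiples of $F^k$ and $F^k G$ as long as the leading form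
  of \<open>Q\<close> commutes with \<open>H\<close>. Throughout, $[F,Q] = c(2G - T)$ with \<open>T\<close> of weight below $bD$, so the
  process stops exactly when the leading form $Q_0$ satisfies $[H, Q_0] = c' H^{b-1}$ with $c' \ne 0$.
  As $(1,1)$ lies in the cone over $[v,v']$, comparing coefficients shows that this equation has no polynomial
  solution if $\mathrm{wt}(1,1) \le D$. Otherwise \<open>P\<close> is a triangle with vertices $0$, $(k,0)$, $(0,1)$ up to
  exchanging the variables; then \<open>F\<close> is quadratic in one variable, and completing the square
  reduces the claim to a recursion for the coefficients of \<open>G\<close>.
\<close>

section \<open>Leading forms along an edge direction\<close>

text \<open>Integer exponents, with zero coefficients outside the quadrant, allow exponents to be
  subtracted and lattice lines to be followed past the axes without case distinctions.\<close>

definition icoeff :: "'a::zero poly poly \<Rightarrow> int \<Rightarrow> int \<Rightarrow> 'a" where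
  "icoeff f i j = (if 0 \<le> i \<and> 0 \<le> j then bicoeff f (nat i) (nat j) else 0)"

lemma icoeff_of_nat [simp]: "icoeff f (int i) (int j) = bicoeff f i j"
  by (simp add: icoeff_def)

lemma icoeff_nonzeroD:
  assumes "icoeff f i j \<noteq> 0"
  shows "0 \<le> i" "0 \<le> j" "(nat i, nat j) \<in> supp f"
  using assms by (auto simp: icoeff_def supp_def split: if_splits)

lemma icoeff_add: "icoeff (f + g) i j = icoeff f i j + icoeff g i j"
  and icoeff_diff: "icoeff (f' - g') i j = icoeff f' i j - icoeff g' i j"
  for f g :: "'a::comm_monoid_add poly poly" and f' g' :: "'b::ab_group_add poly poly"
  by (simp_all add: icoeff_def bicoeff_def)

lemma icoeff_const_mult: "icoeff ([:[:c:]:] * f) i j = c * icoeff f i j"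
  for c :: "'a::comm_semiring_0"
  by (simp add: icoeff_def bicoeff_def)

lemma icoeff_const: "icoeff [:[:c:]:] i j = (if i = 0 \<and> j = 0 then c else 0)"
  by (auto simp: icoeff_def bicoeff_def coeff_pCons split: nat.splits)

lemma icoeff_one: "icoeff (1 :: 'a::comm_semiring_1 poly poly) i j = (if i = 0 \<and> j = 0 then 1 else 0)"
  using icoeff_const[of "1 :: 'a" i j] by (simp only: one_pCons[symmetric])

lemma finite_supp: "finite (supp f)"
proof (rule finite_subset)
  let ?B = "\<Union>j\<in>{..degree f}. (\<lambda>i. (i, j)) ` {..degree (coeff f j)}"
  show "supp f \<subseteq> ?B"
  proof clarify
    fix i j assume "(i, j) \<in> supp f"
    then have *: "coeff (coeff f j) i \<noteq> 0" by (simp add: supp_def bicoeff_def)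
    then have "coeff f j \<noteq> 0" by auto
    then have "j \<le> degree f" by (rule le_degree)
    moreover have "i \<le> degree (coeff f j)" using * by (rule le_degree)
    ultimately show "(i, j) \<in> ?B" by auto
  qed
qed auto

lemma finite_icoeff: "finite {(i, j). icoeff f i j \<noteq> 0}"
proof (rule finite_subset)
  show "{(i, j). icoeff f i j \<noteq> 0} \<subseteq> (\<lambda>(i, j). (int i, int j)) ` supp f"
  proof clarify
    fix i j assume "icoeff f i j \<noteq> 0"
    from icoeff_nonzeroD[OF this] show "(i, j) \<in> (\<lambda>(i, j). (int i, int j)) ` supp f"
      by (intro image_eqI[of _ _ "(nat i, nat j)"]) auto
  qed
qed (simp add: finite_supp)

lemma bicoeff_mult:
  fixes f g :: "'a::comm_semiring_0 poly poly"
  shows "bicoeff (f * g) i j = (\<Sum>(k, l)\<in>{..i} \<times> {..j}. bicoeff f k l * bicoeff g (i - k) (j - l))"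
proof -
  have "bicoeff (f * g) i j = (\<Sum>l\<le>j. \<Sum>k\<le>i. bicoeff f k l * bicoeff g (i - k) (j - l))"
    by (simp add: bicoeff_def coeff_mult coeff_sum)
  also have "\<dots> = (\<Sum>k\<le>i. \<Sum>l\<le>j. bicoeff f k l * bicoeff g (i - k) (j - l))"
    by (rule sum.swap)
  finally show ?thesis
    by (simp add: sum.cartesian_product)
qed

text \<open>Any finite \<open>S\<close> that catches all contributing pairs may index the
  convolution: later a stretch of a lattice line, and \<open>S = {}\<close> to extract a
  contributing pair from a nonzero coefficient of a product.\<close>

lemma icoeff_mult:
  fixes f g :: "'a::comm_semiring_0 poly poly"
  assumes "finite S"
    and "\<And>k l. icoeff f k l \<noteq> 0 \<Longrightarrow> icoeff g (i - k) (j - l) \<noteq> 0 \<Longrightarrow> (k, l) \<in> S"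
  shows "icoeff (f * g) i j = (\<Sum>(k, l)\<in>S. icoeff f k l * icoeff g (i - k) (j - l))"
proof (cases "0 \<le> i \<and> 0 \<le> j")
  case True
  let ?h = "\<lambda>(k, l). icoeff f k l * icoeff g (i - k) (j - l)"
  have "icoeff (f * g) i j =
      (\<Sum>(k, l)\<in>{..nat i} \<times> {..nat j}. bicoeff f k l * bicoeff g (nat i - k) (nat j - l))"
    using True by (simp add: icoeff_def bicoeff_mult)
  also have "\<dots> = sum ?h ({0..i} \<times> {0..j})"
  proof (rule sum.reindex_bij_witness[where i = "\<lambda>(k, l). (nat k, nat l)" and j = "\<lambda>(k, l). (int k, int l)"])
    fix p assume p: "p \<in> {..nat i} \<times> {..nat j}"
    obtain k l where kl: "p = (k, l)" by force
    then have *: "i - int k = int (nat i - k)" "j - int l = int (nat j - l)"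
      using p True by auto
    show "(case case p of (k, l) \<Rightarrow> (int k, int l) of (k, l) \<Rightarrow> icoeff f k l * icoeff g (i - k) (j - l)) =
         (case p of (k, l) \<Rightarrow> bicoeff f k l * bicoeff g (nat i - k) (nat j - l))"
      unfolding kl prod.case * by simp
  qed (use True in auto)
  also have "\<dots> = sum ?h ({0..i} \<times> {0..j} \<inter> S)"
  proof (rule sum.mono_neutral_right)
    show "\<forall>p\<in>{0..i} \<times> {0..j} - {0..i} \<times> {0..j} \<inter> S. ?h p = 0"
      using assms(2) by force
  qed auto
  also have "\<dots> = sum ?h S"
  proof (rule sum.mono_neutral_left[OF assms(1)])
    show "\<forall>p\<in>S - {0..i} \<times> {0..j} \<inter> S. ?h p = 0"
    proof
      fix p assume p: "p \<in> S - {0..i} \<times> {0..j} \<inter> S"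
      obtain k l where kl: "p = (k, l)" by force
      then have "icoeff f k l = 0 \<or> icoeff g (i - k) (j - l) = 0"
        using p by (auto simp: icoeff_def)
      then show "?h p = 0" using kl by auto
    qed
  qed auto
  finally show ?thesis .
next
  case False
  have "(case p of (k, l) \<Rightarrow> icoeff f k l * icoeff g (i - k) (j - l)) = 0" for p
    using False by (auto simp: icoeff_def split: prod.splits)
  then have "(\<Sum>(k, l)\<in>S. icoeff f k l * icoeff g (i - k) (j - l)) = 0"
    by (rule sum.neutral[OF ballI])
  then show ?thesis
    using False by (auto simp: icoeff_def)
qed

lemma icoeff_pderiv_x: "icoeff (pderiv_x f) i j = of_int (i + 1) * icoeff f (i + 1) j"
  for f :: "'a::field poly poly"
proof (cases "i + 1 = 0")
  case False
  then show ?thesis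
    by (auto simp: icoeff_def bicoeff_def pderiv_x_def coeff_map_poly coeff_pderiv nat_add_distrib)
qed (auto simp: icoeff_def)

lemma icoeff_pderiv_y: "icoeff (pderiv_y f) i j = of_int (j + 1) * icoeff f i (j + 1)"
  for f :: "'a::field poly poly"
proof (cases "j + 1 = 0")
  case False
  have "of_nat (Suc (nat j)) * x = smult (of_nat (Suc (nat j))) x" for x :: "'a poly"
    by (simp add: of_nat_poly)
  moreover have "of_nat (Suc (nat j)) = (of_int (j + 1) :: 'a)" if "0 \<le> j"
    using that by (metis Suc_nat_eq_nat_zadd1 add.commute of_nat_nat add_increasing zero_le_one)
  ultimately show ?thesis using False
    by (auto simp: icoeff_def bicoeff_def pderiv_y_def coeff_pderiv nat_add_distrib
        simp del: of_nat_Suc of_int_add)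
qed (auto simp: icoeff_def)

lemma coeff_of_int_mult: "coeff (of_int k * p) n = of_int k * coeff p n"
  for p :: "'a::comm_ring_1 poly"
  by (simp add: of_int_poly)

lemma coeff_X_pderiv: "coeff ([:0, 1:] * pderiv p) n = of_nat n * coeff p n"
  for p :: "'a::{comm_semiring_1,semiring_no_zero_divisors} poly"
  by (cases n) (simp_all add: coeff_pderiv)

text \<open>On a monomial times a polynomial in z, x d/dx and y d/dy act as r + m z d/dz and s + n z
  d/dz. In the determinant of these derivatives the two terms with a' b' cancel.\<close>

lemma log_derivative_determinant:
  fixes a b :: "'a::comm_ring_1"
  shows "(r * a + m * (X * a')) * (s' * b + n * (X * b')) - (r' * b + m * (X * b')) * (s * a + n * (X * a')) =
    (r * s' - r' * s) * (a * b) + (r * n - s * m) * (X * a * b') - (r' * n - s' * m) * (X * a' * b)"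
  by (simp add: algebra_simps)

section \<open>Grading by a primitive lattice direction\<close>

locale edge_direction =
  fixes m1 m2 :: int
  assumes coprime: "coprime m1 m2"
begin

definition wt :: "int \<Rightarrow> int \<Rightarrow> int" where
  "wt i j = i * m2 - j * m1"

definition bounded_by :: "'a::zero poly poly \<Rightarrow> int \<Rightarrow> bool" where
  "bounded_by f k \<longleftrightarrow> (\<forall>i j. icoeff f i j \<noteq> 0 \<longrightarrow> wt i j \<le> k)"

text \<open>
  If \<open>starts_at f r s\<close> and the polynomial below is nonzero, then $x^r y^s$ times
  \<open>edge_poly f r s\<close> at $z = x^{m_1} y^{m_2}$ is the leading form of \<open>f\<close>. The exponents \<open>r\<close>, \<open>s\<close> may be
  negative, and \<open>starts_at f r s\<close> also holds when \<open>f\<close> has smaller weight than $(r,s)$.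
\<close>

definition starts_at :: "'a::zero poly poly \<Rightarrow> int \<Rightarrow> int \<Rightarrow> bool" where
  "starts_at f r s \<longleftrightarrow> (\<forall>i j. icoeff f i j \<noteq> 0 \<longrightarrow>
     wt i j < wt r s \<or> (\<exists>n::nat. i = r + int n * m1 \<and> j = s + int n * m2))"

definition edge_poly :: "'a::zero poly poly \<Rightarrow> int \<Rightarrow> int \<Rightarrow> 'a poly" where
  "edge_poly f r s = Abs_poly (\<lambda>n. icoeff f (r + int n * m1) (s + int n * m2))"

lemma nonzero: "m1 \<noteq> 0 \<or> m2 \<noteq> 0"
  using coprime by auto

lemma shift_eq_iff: "r + int n * m1 = r + int k * m1 \<and> s + int n * m2 = s + int k * m2 \<longleftrightarrow> n = k"
  using nonzero by auto

lemma wt_add: "wt (i + i') (j + j') = wt i j + wt i' j'"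
  and wt_diff: "wt (i - i') (j - j') = wt i j - wt i' j'"
  and wt_scale: "wt (k * i) (k * j) = k * wt i j"
  and wt_shift [simp]: "wt (i + k * m1) (j + k * m2) = wt i j"
  and wt_shift' [simp]: "wt (i - k * m1) (j - k * m2) = wt i j"
  by (simp_all add: wt_def algebra_simps)

text \<open>Finitely many coefficients of \<open>f\<close> are nonzero and n is determined by its
  point on the line, so the sequence under \<open>Abs_poly\<close> has finite support.\<close>

lemma coeff_edge_poly: "coeff (edge_poly f r s) n = icoeff f (r + int n * m1) (s + int n * m2)"
proof -
  let ?p = "\<lambda>n. (r + int n * m1, s + int n * m2)"
  have "inj ?p"
    using shift_eq_iff by (auto intro!: injI)
  then have "finite (?p -` {(i, j). icoeff f i j \<noteq> 0})"
    by (intro finite_vimageI finite_icoeff)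
  then obtain N where "\<forall>n\<in>?p -` {(i, j). icoeff f i j \<noteq> 0}. n \<le> N"
    using finite_nat_set_iff_bounded_le by blast
  then have "icoeff f (r + int n * m1) (s + int n * m2) = 0" if "n > N" for n
    using that by force
  then show ?thesis
    unfolding edge_poly_def by (subst coeff_Abs_poly[of N]) auto
qed

lemma starts_atD:
  assumes "starts_at f r s" "icoeff f i j \<noteq> 0" "wt r s \<le> wt i j"
  obtains n :: nat where "i = r + int n * m1" "j = s + int n * m2"
  using assms unfolding starts_at_def by fastforce

lemma starts_at_imp_bounded: "starts_at f r s \<Longrightarrow> bounded_by f (wt r s)"
  unfolding starts_at_def bounded_by_def by fastforce

lemma bounded_mult:
  fixes f g :: "'a::comm_semiring_0 poly poly"
  assumes "bounded_by f k" "bounded_by g l"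
  shows "bounded_by (f * g) (k + l)"
  unfolding bounded_by_def
proof (intro allI impI)
  fix i j assume "icoeff (f * g) i j \<noteq> 0"
  then obtain a b where ab: "icoeff f a b \<noteq> 0" "icoeff g (i - a) (j - b) \<noteq> 0"
    using icoeff_mult[of "{}" f g i j] by auto
  then have "wt a b \<le> k" "wt (i - a) (j - b) \<le> l"
    using assms by (auto simp: bounded_by_def)
  then show "wt i j \<le> k + l"
    by (simp add: wt_diff)
qed

lemma starts_at_mult:
  fixes f g :: "'a::comm_semiring_0 poly poly"
  assumes f: "starts_at f r s" and g: "starts_at g r' s'"
  shows "starts_at (f * g) (r + r') (s + s')"
  unfolding starts_at_def
proof (intro allI impI)
  fix i j assume "icoeff (f * g) i j \<noteq> 0"
  then obtain a b where ab: "icoeff f a b \<noteq> 0" "icoeff g (i - a) (j - b) \<noteq> 0"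
    using icoeff_mult[of "{}" f g i j] by auto
  have "(wt a b < wt r s \<or> (\<exists>n::nat. a = r + int n * m1 \<and> b = s + int n * m2))"
    and "(wt (i - a) (j - b) < wt r' s' \<or> (\<exists>n::nat. i - a = r' + int n * m1 \<and> j - b = s' + int n * m2))"
    using ab f g unfolding starts_at_def by blast+
  moreover have "wt a b \<le> wt r s" "wt (i - a) (j - b) \<le> wt r' s'"
    using ab f g starts_at_imp_bounded unfolding bounded_by_def by blast+
  moreover have "wt (r + r') (s + s') = wt r s + wt r' s'" "wt i j = wt a b + wt (i - a) (j - b)"
    by (simp_all add: wt_add wt_diff)
  moreover have "\<exists>n::nat. i = r + r' + int n * m1 \<and> j = s + s' + int n * m2"
    if "a = r + int n * m1 \<and> b = s + int n * m2" "i - a = r' + int k * m1 \<and> j - b = s' + int k * m2" for n k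
    using that by (intro exI[of _ "n + k"]) (auto simp: algebra_simps)
  ultimately show "wt i j < wt (r + r') (s + s') \<or>
      (\<exists>n::nat. i = r + r' + int n * m1 \<and> j = s + s' + int n * m2)"
    by force
qed

text \<open>Weights add, so a contribution of top weight needs both factors of top weight. Both then
  lie on their progressions, and what remains is a convolution in one variable.\<close>

lemma edge_poly_mult:
  fixes f g :: "'a::comm_semiring_0 poly poly"
  assumes f: "starts_at f r s" and g: "starts_at g r' s'"
  shows "edge_poly (f * g) (r + r') (s + s') = edge_poly f r s * edge_poly g r' s'"
proof (rule poly_eqI)
  fix n
  define i j where ij: "i = r + r' + int n * m1" "j = s + s' + int n * m2"
  let ?p = "\<lambda>k. (r + int k * m1, s + int k * m2)"
  have inj: "inj_on ?p {..n}"
    using shift_eq_iff by (auto intro!: inj_onI)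
  have "coeff (edge_poly (f * g) (r + r') (s + s')) n = icoeff (f * g) i j"
    by (simp add: coeff_edge_poly ij)
  also have "\<dots> = (\<Sum>(k, l)\<in>?p ` {..n}. icoeff f k l * icoeff g (i - k) (j - l))"
  proof (rule icoeff_mult)
    fix a b assume ab: "icoeff f a b \<noteq> 0" "icoeff g (i - a) (j - b) \<noteq> 0"
    have "wt i j = wt r s + wt r' s'"
      unfolding ij by (simp add: wt_def algebra_simps)
    moreover have "wt a b \<le> wt r s" "wt (i - a) (j - b) \<le> wt r' s'"
      using ab f g starts_at_imp_bounded unfolding bounded_by_def by blast+
    ultimately have ge: "wt r s \<le> wt a b" "wt r' s' \<le> wt (i - a) (j - b)"
      by (simp_all add: wt_diff)
    obtain k where k: "a = r + int k * m1" "b = s + int k * m2"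
      using starts_atD[OF f ab(1) ge(1)] .
    obtain l where l: "i - a = r' + int l * m1" "j - b = s' + int l * m2"
      using starts_atD[OF g ab(2) ge(2)] .
    have "0 + int (k + l) * m1 = 0 + int n * m1" "0 + int (k + l) * m2 = 0 + int n * m2"
      using k l by (simp_all add: ij algebra_simps)
    then have "k + l = n"
      using shift_eq_iff by blast
    then show "(a, b) \<in> ?p ` {..n}"
      using k by auto
  qed auto
  also have "\<dots> = (\<Sum>k\<le>n. icoeff f (r + int k * m1) (s + int k * m2) *
      icoeff g (i - (r + int k * m1)) (j - (s + int k * m2)))"
    by (subst sum.reindex[OF inj]) simp
  also have "\<dots> = coeff (edge_poly f r s * edge_poly g r' s') n"
    unfolding coeff_mult coeff_edge_poly
    by (rule sum.cong) (auto simp: ij of_nat_diff algebra_simps)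
  finally show "coeff (edge_poly (f * g) (r + r') (s + s')) n = coeff (edge_poly f r s * edge_poly g r' s') n" .
qed

lemma starts_at_diff:
  fixes f g :: "'a::ab_group_add poly poly"
  assumes "starts_at f r s" "starts_at g r s"
  shows "starts_at (f - g) r s"
  using assms unfolding starts_at_def icoeff_diff by (metis diff_zero)

lemma edge_poly_diff:
  fixes f g :: "'a::ab_group_add poly poly"
  shows "edge_poly (f - g) r s = edge_poly f r s - edge_poly g r s"
  by (rule poly_eqI) (simp add: coeff_edge_poly icoeff_diff)

lemma starts_at_const_mult:
  fixes f :: "'a::comm_semiring_0 poly poly"
  shows "starts_at f r s \<Longrightarrow> starts_at ([:[:c:]:] * f) r s"
  unfolding starts_at_def icoeff_const_mult by (metis mult_zero_right)

lemma edge_poly_const_mult: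
  fixes f :: "'a::comm_semiring_0 poly poly"
  shows "edge_poly ([:[:c:]:] * f) r s = smult c (edge_poly f r s)"
  by (rule poly_eqI) (simp only: coeff_edge_poly icoeff_const_mult coeff_smult)

lemma bounded_diff:
  fixes f g :: "'a::ab_group_add poly poly"
  shows "bounded_by f k \<Longrightarrow> bounded_by g k \<Longrightarrow> bounded_by (f - g) k"
  unfolding bounded_by_def icoeff_diff by (metis diff_zero)

lemma bounded_add:
  fixes f g :: "'a::ab_group_add poly poly"
  shows "bounded_by f k \<Longrightarrow> bounded_by g k \<Longrightarrow> bounded_by (f + g) k"
  unfolding bounded_by_def icoeff_add by (metis add.right_neutral)

lemma bounded_const_mult:
  fixes f :: "'a::comm_semiring_0 poly poly"
  shows "bounded_by f k \<Longrightarrow> bounded_by ([:[:c:]:] * f) k"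
  unfolding bounded_by_def icoeff_const_mult by (metis mult_zero_right)

lemma bounded_mono: "bounded_by f k \<Longrightarrow> k \<le> l \<Longrightarrow> bounded_by f l"
  unfolding bounded_by_def by fastforce

lemma edge_poly_eq_0:
  assumes "bounded_by f k" "k < wt r s"
  shows "edge_poly f r s = 0"
proof (rule poly_eqI)
  show "coeff (edge_poly f r s) n = coeff 0 n" for n
    using assms unfolding bounded_by_def coeff_edge_poly
    by (metis coeff_0 linorder_not_le wt_shift)
qed

lemma starts_at_power:
  fixes f :: "'a::comm_semiring_1 poly poly"
  assumes "starts_at f r s"
  shows "starts_at (f ^ k) (int k * r) (int k * s)"
    and "edge_poly (f ^ k) (int k * r) (int k * s) = edge_poly f r s ^ k"
proof (induction k)
  case 0
  { case 1
    show ?case by (auto simp: starts_at_def icoeff_one split: if_splits intro: exI[of _ 0]) }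
  { case 2
    show ?case using nonzero
      by (intro poly_eqI) (auto simp: coeff_edge_poly icoeff_one) }
next
  case (Suc k)
  { case 1 show ?case using starts_at_mult[OF assms Suc(1)] by (simp add: algebra_simps) }
  { case 2 show ?case using edge_poly_mult[OF assms Suc(1)] Suc(2) by (simp add: algebra_simps) }
qed

lemma starts_at_pderiv_x:
  fixes f :: "'a::field poly poly"
  assumes "starts_at f r s"
  shows "starts_at (pderiv_x f) (r - 1) s"
  unfolding starts_at_def
proof (intro allI impI)
  fix i j assume "icoeff (pderiv_x f) i j \<noteq> 0"
  then have "icoeff f (i + 1) j \<noteq> 0"
    by (auto simp: icoeff_pderiv_x)
  then have "wt (i + 1) j < wt r s \<or> (\<exists>n::nat. i + 1 = r + int n * m1 \<and> j = s + int n * m2)"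
    using assms by (auto simp: starts_at_def)
  then show "wt i j < wt (r - 1) s \<or> (\<exists>n::nat. i = r - 1 + int n * m1 \<and> j = s + int n * m2)"
    by (auto simp: wt_def algebra_simps)
qed

lemma starts_at_pderiv_y:
  fixes f :: "'a::field poly poly"
  assumes "starts_at f r s"
  shows "starts_at (pderiv_y f) r (s - 1)"
  unfolding starts_at_def
proof (intro allI impI)
  fix i j assume "icoeff (pderiv_y f) i j \<noteq> 0"
  then have "icoeff f i (j + 1) \<noteq> 0"
    by (auto simp: icoeff_pderiv_y)
  then have "wt i (j + 1) < wt r s \<or> (\<exists>n::nat. i = r + int n * m1 \<and> j + 1 = s + int n * m2)"
    using assms by (auto simp: starts_at_def)
  then show "wt i j < wt r (s - 1) \<or> (\<exists>n::nat. i = r + int n * m1 \<and> j = s - 1 + int n * m2)"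
    by (auto simp: wt_def algebra_simps)
qed

text \<open>x d/dx acts on x^r y^s p(z) as r + m1 z d/dz; the start \<open>r - 1\<close> accounts
  for the missing factor x.\<close>

lemma edge_poly_pderiv_x:
  fixes f :: "'a::field poly poly"
  shows "edge_poly (pderiv_x f) (r - 1) s =
    of_int r * edge_poly f r s + of_int m1 * ([:0, 1:] * pderiv (edge_poly f r s))"
  by (rule poly_eqI, simp only: coeff_add coeff_of_int_mult coeff_X_pderiv coeff_edge_poly icoeff_pderiv_x)
     (simp add: algebra_simps)

lemma edge_poly_pderiv_y:
  fixes f :: "'a::field poly poly"
  shows "edge_poly (pderiv_y f) r (s - 1) =
    of_int s * edge_poly f r s + of_int m2 * ([:0, 1:] * pderiv (edge_poly f r s))"
  by (rule poly_eqI, simp only: coeff_add coeff_of_int_mult coeff_X_pderiv coeff_edge_poly icoeff_pderiv_y)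
     (simp add: algebra_simps)

text \<open>The edge polynomials of the four derivatives multiply, and
  \<open>log_derivative_determinant\<close> simplifies their combination. When the right-hand side
  vanishes, the leading forms commute.\<close>

lemma edge_poly_bracket:
  fixes f g :: "'a::field poly poly"
  assumes f: "starts_at f r s" and g: "starts_at g r' s'"
  defines "p \<equiv> edge_poly f r s" and "q \<equiv> edge_poly g r' s'"
  shows "edge_poly (jacobian_bracket f g) (r + r' - 1) (s + s' - 1) =
    of_int (r * s' - r' * s) * (p * q) + of_int (wt r s) * ([:0, 1:] * p * pderiv q)
      - of_int (wt r' s') * ([:0, 1:] * pderiv p * q)"
proof -
  have "edge_poly (pderiv_x f * pderiv_y g) (r + r' - 1) (s + s' - 1) =
      edge_poly (pderiv_x f) (r - 1) s * edge_poly (pderiv_y g) r' (s' - 1)"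
    using edge_poly_mult[OF starts_at_pderiv_x[OF f] starts_at_pderiv_y[OF g]]
    by (simp add: algebra_simps)
  moreover have "edge_poly (pderiv_x g * pderiv_y f) (r + r' - 1) (s + s' - 1) =
      edge_poly (pderiv_x g) (r' - 1) s' * edge_poly (pderiv_y f) r (s - 1)"
    using edge_poly_mult[OF starts_at_pderiv_x[OF g] starts_at_pderiv_y[OF f]]
    by (simp add: algebra_simps)
  ultimately show ?thesis
    unfolding jacobian_bracket_def edge_poly_diff edge_poly_pderiv_x edge_poly_pderiv_y
      p_def[symmetric] q_def[symmetric] wt_def
    by (simp only: of_int_diff of_int_mult log_derivative_determinant)
qed

text \<open>Points of equal weight differ by a vector proportional to (m1, m2); as this vector is
  primitive, the factor is an integer.\<close>

lemma collinear_imp_shift: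
  assumes "wt i j = wt r s"
  obtains k where "i = r + k * m1" "j = s + k * m2"
proof -
  have eq: "(i - r) * m2 = (j - s) * m1"
    using assms by (simp add: wt_def algebra_simps)
  then have "m1 dvd (i - r) * m2" by simp
  then have "m1 dvd i - r"
    using coprime by (simp add: coprime_dvd_mult_left_iff)
  then obtain k where k: "i - r = m1 * k" ..
  show thesis
  proof (cases "m1 = 0")
    case True
    then have "m2 = 1 \<or> m2 = -1" using coprime by auto
    then have "j = s + ((j - s) * m2) * m2" by auto
    then show ?thesis using True k by (intro that[of "(j - s) * m2"]) auto
  next
    case False
    then have "j - s = k * m2" using eq k by (simp add: ac_simps)
    then show ?thesis using k by (intro that[of k]) (auto simp: algebra_simps)
  qed
qed

text \<open>Finitely many points on the line through (r, s) carry coefficients, so a start far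
  enough back catches them all.\<close>

lemma starts_at_below:
  assumes "bounded_by f (wt r s)"
  obtains N :: nat where "starts_at f (r - int N * m1) (s - int N * m2)"
proof -
  have "finite {k. icoeff f (r + k * m1) (s + k * m2) \<noteq> 0}"
  proof -
    have "inj (\<lambda>k. (r + k * m1, s + k * m2))"
      using nonzero by (auto intro!: injI)
    from finite_vimageI[OF finite_icoeff this, of f] show ?thesis
      by (simp add: vimage_def)
  qed
  then obtain M where M: "\<And>k. icoeff f (r + k * m1) (s + k * m2) \<noteq> 0 \<Longrightarrow> M \<le> k"
    by (metis (mono_tags, lifting) bdd_below.E bdd_below_finite mem_Collect_eq)
  have "starts_at f (r - int (nat (-M)) * m1) (s - int (nat (-M)) * m2)"
    unfolding starts_at_def
  proof (intro allI impI)
    fix i j assume ij: "icoeff f i j \<noteq> 0"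
    let ?N = "int (nat (-M))"
    show "wt i j < wt (r - ?N * m1) (s - ?N * m2) \<or>
      (\<exists>n::nat. i = r - ?N * m1 + int n * m1 \<and> j = s - ?N * m2 + int n * m2)"
    proof (cases "wt i j = wt r s")
      case True
      then obtain k where k: "i = r + k * m1" "j = s + k * m2"
        by (rule collinear_imp_shift)
      then have "int (nat (k + ?N)) = k + ?N"
        using M[of k] ij by auto
      then show ?thesis
        using k by (intro disjI2 exI[of _ "nat (k + ?N)"]) (simp add: algebra_simps)
    next
      case False
      then show ?thesis
        using assms ij by (force simp: bounded_by_def)
    qed
  qed
  then show thesis by (rule that)
qed

text \<open>Needed to compare leading forms that start at different points of one line. The N new
  coefficients at the front vanish, since nothing of top weight precedes the original start.\<close>

lemma edge_poly_shift:
  fixes f :: "'a::comm_semiring_1 poly poly"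
  assumes "starts_at f r s"
  shows "starts_at f (r - int N * m1) (s - int N * m2)"
    and "edge_poly f (r - int N * m1) (s - int N * m2) = [:0, 1:] ^ N * edge_poly f r s"
proof -
  show "starts_at f (r - int N * m1) (s - int N * m2)"
    unfolding starts_at_def
  proof (intro allI impI)
    fix i j assume "icoeff f i j \<noteq> 0"
    with assms consider "wt i j < wt r s" | n :: nat where "i = r + int n * m1" "j = s + int n * m2"
      unfolding starts_at_def by blast
    then show "wt i j < wt (r - int N * m1) (s - int N * m2) \<or>
      (\<exists>n::nat. i = r - int N * m1 + int n * m1 \<and> j = s - int N * m2 + int n * m2)"
    proof cases
      case 2
      then show ?thesis by (intro disjI2 exI[of _ "n + N"]) (simp add: algebra_simps)
    qed simp
  qed
  show "edge_poly f (r - int N * m1) (s - int N * m2) = [:0, 1:] ^ N * edge_poly f r s"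
  proof (rule poly_eqI)
    fix n
    show "coeff (edge_poly f (r - int N * m1) (s - int N * m2)) n = coeff ([:0, 1:] ^ N * edge_poly f r s) n"
    proof (cases "n < N")
      case True
      have "icoeff f (r - int N * m1 + int n * m1) (s - int N * m2 + int n * m2) = 0"
      proof (rule ccontr)
        assume "\<not> ?thesis"
        then obtain k :: nat where "r - int N * m1 + int n * m1 = r + int k * m1"
          "s - int N * m2 + int n * m2 = s + int k * m2"
          by (rule starts_atD[OF assms]) simp
        then have "(int n - int N - int k) * m1 = 0" "(int n - int N - int k) * m2 = 0"
          by (simp_all add: algebra_simps)
        then show False using nonzero True by auto
      qed
      then show ?thesis using True
        by (simp add: coeff_edge_poly coeff_monom_mult flip: monom_altdef[of 1 N, simplified])
    next
      case False
      then have "r - int N * m1 + int n * m1 = r + int (n - N) * m1"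
        "s - int N * m2 + int n * m2 = s + int (n - N) * m2"
        by (simp_all add: of_nat_diff algebra_simps)
      then have "coeff (edge_poly f (r - int N * m1) (s - int N * m2)) n = coeff (edge_poly f r s) (n - N)"
        unfolding coeff_edge_poly by (simp only:)
      then show ?thesis using False
        by (simp add: coeff_monom_mult flip: monom_altdef[of 1 N, simplified])
    qed
  qed
qed

text \<open>The start is the point of lowest index in the edge polynomial from
  \<open>starts_at_below\<close>; its nonzero constant coefficient makes evaluation at z = 0
  informative later.\<close>

lemma starts_at_exact:
  fixes f :: "'a::comm_semiring_1 poly poly"
  assumes "bounded_by f k" "icoeff f i j \<noteq> 0" "wt i j = k"
  obtains r s where "starts_at f r s" "icoeff f r s \<noteq> 0" "wt r s = k"
proof -
  obtain N where N: "starts_at f (i - int N * m1) (j - int N * m2)"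
    using starts_at_below[of f i j] assms by blast
  let ?p = "edge_poly f (i - int N * m1) (j - int N * m2)"
  define n where "n = (LEAST n. coeff ?p n \<noteq> 0)"
  have "coeff ?p N \<noteq> 0"
    using assms(2) by (simp add: coeff_edge_poly)
  then have n: "coeff ?p n \<noteq> 0"
    unfolding n_def by (rule LeastI)
  have n_le: "n \<le> l" if "coeff ?p l \<noteq> 0" for l
    unfolding n_def using that by (rule Least_le)
  let ?r = "i - int N * m1 + int n * m1" and ?s = "j - int N * m2 + int n * m2"
  have "starts_at f ?r ?s"
    unfolding starts_at_def
  proof (intro allI impI)
    fix a b assume ab: "icoeff f a b \<noteq> 0"
    with N consider "wt a b < wt (i - int N * m1) (j - int N * m2)"
      | l :: nat where "a = i - int N * m1 + int l * m1" "b = j - int N * m2 + int l * m2"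
      unfolding starts_at_def by blast
    then show "wt a b < wt ?r ?s \<or> (\<exists>n::nat. a = ?r + int n * m1 \<and> b = ?s + int n * m2)"
    proof cases
      case 2
      then have "n \<le> l" using ab n_le[of l] by (simp add: coeff_edge_poly)
      then show ?thesis using 2
        by (intro disjI2 exI[of _ "l - n"]) (simp add: of_nat_diff algebra_simps)
    qed simp
  qed
  moreover have "icoeff f ?r ?s \<noteq> 0"
    using n by (simp add: coeff_edge_poly)
  ultimately show thesis
    using that[of ?r ?s] assms(3) by simp
qed

text \<open>Weights are integers, so cancelling the leading form lowers the bound by at least one;
  this makes the reduction terminate.\<close>

lemma bounded_less:
  assumes "starts_at f r s" "edge_poly f r s = 0"
  shows "bounded_by f (wt r s - 1)"
  unfolding bounded_by_def
proof (intro allI impI)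
  fix i j assume ij: "icoeff f i j \<noteq> 0"
  show "wt i j \<le> wt r s - 1"
  proof (rule ccontr)
    assume "\<not> ?thesis"
    then have "wt r s \<le> wt i j" by simp
    from starts_atD[OF assms(1) ij this] obtain n :: nat where "i = r + int n * m1" "j = s + int n * m2" .
    then have "icoeff f i j = coeff (edge_poly f r s) n" by (simp add: coeff_edge_poly)
    with ij assms(2) show False by simp
  qed
qed

end

section \<open>Univariate equations\<close>

lemma linear_mult_pderiv_power:
  "[:-\<rho>, 1:] * pderiv ([:-\<rho>, 1:] ^ n) = of_nat n * [:-\<rho>, 1:] ^ n"
  for \<rho> :: "'a::field_char_0"
proof (cases n)
  case (Suc k)
  have "pderiv [:-\<rho>, 1:] = 1" by (simp add: pderiv_pCons)
  then have "[:-\<rho>, 1:] * pderiv ([:-\<rho>, 1:] ^ n) = smult (of_nat n) ([:-\<rho>, 1:] * [:-\<rho>, 1:] ^ k)"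
    unfolding Suc pderiv_power_Suc by (simp only: mult_1_right mult_smult_right)
  also have "\<dots> = of_nat n * [:-\<rho>, 1:] ^ n"
    unfolding Suc power_Suc of_nat_poly by simp
  finally show ?thesis .
qed simp

lemma of_int_poly_eq_0_iff [simp]: "(of_int k :: 'a::field_char_0 poly) = 0 \<longleftrightarrow> k = 0"
  by (simp add: of_int_poly)

lemma poly_of_int [simp]: "poly (of_int k) (x :: 'a::comm_ring_1) = of_int k"
  by (simp add: of_int_poly)

text \<open>Once the full power of the root is pulled out, only the multiplicity n survives
  evaluation at \<rho>. This turns differential equations into equations between
  multiplicities.\<close>

lemma root_power_decomposition:
  fixes p :: "'a::field_char_0 poly"
  assumes "p \<noteq> 0"
  obtains n u where "p = [:-\<rho>, 1:] ^ n * u" "poly u \<rho> \<noteq> 0" "n = order \<rho> p"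
    "[:-\<rho>, 1:] * pderiv p = [:-\<rho>, 1:] ^ n * ([:-\<rho>, 1:] * pderiv u + of_nat n * u)"
proof -
  obtain u where u: "p = [:-\<rho>, 1:] ^ order \<rho> p * u" "\<not> [:-\<rho>, 1:] dvd u"
    using order_decomp[OF assms] by blast
  let ?n = "order \<rho> p"
  have "[:-\<rho>, 1:] * pderiv ([:-\<rho>, 1:] ^ ?n * u) =
      [:-\<rho>, 1:] ^ ?n * ([:-\<rho>, 1:] * pderiv u) + [:-\<rho>, 1:] * pderiv ([:-\<rho>, 1:] ^ ?n) * u"
    unfolding pderiv_mult by (simp only: ring_distribs ac_simps)
  also have "\<dots> = [:-\<rho>, 1:] ^ ?n * ([:-\<rho>, 1:] * pderiv u + of_nat ?n * u)"
    unfolding linear_mult_pderiv_power by (simp only: ring_distribs ac_simps)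
  finally show thesis
    using u that[of ?n u] by (simp only: poly_eq_0_iff_dvd refl not_False_eq_True simp_thms)
qed

text \<open>The equation says that a form of weight k with edge polynomial \<xi> commutes with x^v
  (z - \<rho>) of weight D. Evaluation at 0 gives E = 0. After division by z and by the power of
  \<phi> in \<xi>, evaluation at \<rho> gives k = n D, so the cofactor has derivative 0.\<close>

lemma commuting_with_linear_power:
  fixes \<rho> :: "'a::field_char_0" and \<xi> :: "'a poly" and D k E :: int
  defines "\<phi> \<equiv> [:-\<rho>, 1:]"
  assumes "D > 0" "\<rho> \<noteq> 0" "coeff \<xi> 0 \<noteq> 0"
    and ode: "of_int E * (\<phi> * \<xi>) + of_int D * ([:0, 1:] * \<phi> * pderiv \<xi>) - of_int k * ([:0, 1:] * \<xi>) = 0"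
  obtains n \<kappa> where "E = 0" "\<kappa> \<noteq> 0" "\<xi> = smult \<kappa> (\<phi> ^ n)" "k = int n * D"
proof -
  have \<phi>0: "poly \<phi> 0 = -\<rho>" "poly \<phi> \<rho> = 0" by (simp_all add: \<phi>_def)
  have "\<phi> \<noteq> 0" by (simp add: \<phi>_def)
  from ode have "poly (of_int E * (\<phi> * \<xi>) + of_int D * ([:0, 1:] * \<phi> * pderiv \<xi>) - of_int k * ([:0, 1:] * \<xi>)) 0 = 0"
    by (simp only: poly_0)
  moreover have "poly \<xi> 0 \<noteq> 0"
    using assms(4) by (simp add: poly_0_coeff_0)
  ultimately have E: "E = 0"
    using assms(3) \<phi>0 by simp
  have "[:0, 1:] * (of_int D * (\<phi> * pderiv \<xi>) - of_int k * \<xi>) =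
      of_int E * (\<phi> * \<xi>) + of_int D * ([:0, 1:] * \<phi> * pderiv \<xi>) - of_int k * ([:0, 1:] * \<xi>)"
    unfolding E by (simp only: ring_distribs ac_simps of_int_0 mult_zero_left add_0)
  then have 1: "of_int D * (\<phi> * pderiv \<xi>) - of_int k * \<xi> = 0"
    unfolding ode by (metis mult_eq_0_iff pCons_eq_0_iff zero_neq_one)
  have "\<xi> \<noteq> 0" using assms(4) by auto
  then obtain n u where u: "\<xi> = \<phi> ^ n * u" "poly u \<rho> \<noteq> 0"
    "\<phi> * pderiv \<xi> = \<phi> ^ n * (\<phi> * pderiv u + of_nat n * u)"
    unfolding \<phi>_def by (rule root_power_decomposition)
  have "\<phi> ^ n * (of_int D * (\<phi> * pderiv u) + of_int (int n * D - k) * u) =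
      of_int D * (\<phi> * pderiv \<xi>) - of_int k * \<xi>"
    unfolding u(3) by (subst u(1)) (simp add: algebra_simps)
  then have 2: "of_int D * (\<phi> * pderiv u) + of_int (int n * D - k) * u = 0"
    unfolding 1 using \<open>\<phi> \<noteq> 0\<close> by simp
  then have "poly (of_int D * (\<phi> * pderiv u) + of_int (int n * D - k) * u) \<rho> = 0"
    by (simp only: poly_0)
  then have "(of_int (int n * D - k) :: 'a) = 0"
    using u(2) \<phi>0 by (simp del: of_int_diff of_int_mult)
  then have k: "k = int n * D"
    by (simp only: of_int_eq_0_iff)
  with 2 have "pderiv u = 0"
    using assms(2) \<open>\<phi> \<noteq> 0\<close> by simp
  then obtain \<kappa> where "u = [:\<kappa>:]"
    by (auto simp: pderiv_eq_0_iff elim: degree_eq_zeroE)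
  then show thesis
    using u that[of \<kappa> n] E k by auto
qed

text \<open>f^b and g^2 have equal logarithmic derivatives. At a root of multiplicity n in f and k
  in g this gives 2 k = b n, so n is even because b is odd, and a root of a quadratic must be
  double.\<close>

lemma quadratic_is_square:
  fixes f g :: "'a::{alg_closed_field, field_char_0} poly" and b :: nat
  assumes "degree f = 2" "coeff f 0 \<noteq> 0" "g \<noteq> 0" "odd b"
    and ode: "of_nat 2 * (f * pderiv g) = of_nat b * (pderiv f * g)"
  obtains \<rho> \<gamma> where "\<rho> \<noteq> 0" "\<gamma> \<noteq> 0" "f = smult \<gamma> ([:-\<rho>, 1:]\<^sup>2)"
proof -
  obtain \<rho> where \<rho>: "poly f \<rho> = 0"
    using alg_closed_imp_poly_has_root[of f] assms(1) by auto
  have \<rho>0: "\<rho> \<noteq> 0"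
    using \<rho> assms(2) by (auto simp: poly_0_coeff_0)
  have "f \<noteq> 0" using assms(1) by auto
  define \<phi> where "\<phi> = [:-\<rho>, 1:]"
  have \<phi>: "\<phi> \<noteq> 0" "poly \<phi> \<rho> = 0" "degree \<phi> = 1" by (simp_all add: \<phi>_def)
  obtain n u where f: "f = \<phi> ^ n * u" "poly u \<rho> \<noteq> 0" "n = order \<rho> f"
    "\<phi> * pderiv f = \<phi> ^ n * (\<phi> * pderiv u + of_nat n * u)"
    using root_power_decomposition[OF \<open>f \<noteq> 0\<close>, of \<rho>] unfolding \<phi>_def by metis
  obtain k w where g: "g = \<phi> ^ k * w" "poly w \<rho> \<noteq> 0"
    "\<phi> * pderiv g = \<phi> ^ k * (\<phi> * pderiv w + of_nat k * w)"
    using root_power_decomposition[OF \<open>g \<noteq> 0\<close>, of \<rho>] unfolding \<phi>_def by metis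
  have 1: "of_nat 2 * (f * (\<phi> * pderiv g)) = of_nat b * ((\<phi> * pderiv f) * g)"
    using arg_cong[OF ode, of "\<lambda>p. \<phi> * p"] by (simp only: ac_simps)
  have 2: "f * (\<phi> * pderiv g) = \<phi> ^ (n + k) * (u * (\<phi> * pderiv w + of_nat k * w))"
    unfolding g(3) by (subst f(1)) (simp only: ac_simps power_add)
  have 3: "(\<phi> * pderiv f) * g = \<phi> ^ (n + k) * ((\<phi> * pderiv u + of_nat n * u) * w)"
    unfolding f(4) by (subst g(1)) (simp only: ac_simps power_add)
  have "\<phi> ^ (n + k) * (of_nat 2 * (u * (\<phi> * pderiv w + of_nat k * w))) =
      \<phi> ^ (n + k) * (of_nat b * ((\<phi> * pderiv u + of_nat n * u) * w))"
    using 1[unfolded 2 3] by (simp only: mult.left_commute)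
  then have "of_nat 2 * (u * (\<phi> * pderiv w + of_nat k * w)) =
      of_nat b * ((\<phi> * pderiv u + of_nat n * u) * w)"
    using \<phi>(1) by simp
  then have "poly (of_nat 2 * (u * (\<phi> * pderiv w + of_nat k * w))) \<rho> =
      poly (of_nat b * ((\<phi> * pderiv u + of_nat n * u) * w)) \<rho>"
    by (rule arg_cong)
  then have "(of_nat (2 * k) :: 'a) = of_nat (b * n)"
    using f(2) g(2) \<phi>(2) by (simp add: of_nat_poly)
  then have "2 * k = b * n"
    by (simp only: of_nat_eq_iff)
  then have "even n"
    using \<open>odd b\<close> by (metis dvd_triv_left even_mult_iff)
  have deg: "degree f = n + degree u"
    using f(1,2) \<phi> by (subst f(1), subst degree_mult_eq) (auto simp: degree_power_eq)
  have "n \<noteq> 0"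
    using \<rho> \<open>f \<noteq> 0\<close> f(3) order_root by blast
  with deg assms(1) \<open>even n\<close> have "n = 2" "degree u = 0"
    by presburger+
  then obtain \<gamma> where "u = [:\<gamma>:]"
    by (auto elim: degree_eq_zeroE)
  then show thesis
    using that[of \<rho> \<gamma>] \<rho>0 f(1,2) \<open>n = 2\<close> by (auto simp: \<phi>_def)
qed

lemma coeff_linear_mult:
  "coeff ([:-\<rho>, 1:] * p) n = (if n = 0 then 0 else coeff p (n - 1)) - \<rho> * coeff p n"
  for \<rho> :: "'a::comm_ring_1"
  by (cases n) (simp_all add: coeff_pCons algebra_simps)

text \<open>
  Up to powers of $-\rho$ and a common factor, the coefficients of \<open>\<xi>\<close> satisfy
  $(e + jD) s_j = ((b-1-j)D + e') s_{j-1} + \binom{b-1}{j}$. If $e, e' > 0$, finiteness forces them to vanish outside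
  $0 \le j \le b-2$, whereas in this range they are positive rationals, contradicting the relation
  for $j = b-1$. If $e = 0$ or $e' = 0$, one half of the vanishing already contradicts a single relation.
\<close>

lemma no_edge_solution:
  fixes \<rho> :: "'a::field_char_0" and \<xi> :: "'a poly" and D e e' :: int and b N :: nat
  defines "\<phi> \<equiv> [:-\<rho>, 1:]"
  assumes "D > 0" "0 \<le> e" "0 \<le> e'" "e + e' \<le> D" "b \<ge> 2" "\<rho> \<noteq> 0" "c \<noteq> 0"
    and ode: "of_int (e - int N * D) * (\<phi> * \<xi>) + of_int D * ([:0, 1:] * \<phi> * pderiv \<xi>)
      - of_int ((int b - 2) * D + e + e') * ([:0, 1:] * \<xi>) = smult c ([:0, 1:] ^ N * \<phi> ^ (b - 1))"
  shows False
proof -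
  let ?q = "coeff \<xi>"
  define B where "B j = of_nat ((b - 1) choose j) * (-\<rho>) ^ (b - 1 - j)" for j
  have B: "coeff (\<phi> ^ (b - 1)) j = B j" for j
  proof (cases "j \<le> b - 1")
    case True
    then show ?thesis by (simp add: \<phi>_def B_def coeff_linear_poly_power)
  next
    case False
    then show ?thesis by (simp add: \<phi>_def B_def coeff_eq_0 degree_linear_power binomial_eq_0)
  qed
  \<comment> \<open>Comparison of the coefficients of z^n; the guards stand for zero coefficients at
    negative indices.\<close>
  have rec: "-\<rho> * of_int (e + (int n - int N) * D) * ?q n
      - of_int ((int b - 1 - (int n - int N)) * D + e') * (if n = 0 then 0 else ?q (n - 1)) =
      c * (if n < N then 0 else B (n - N))" for n
  proof -
    have 1: "coeff ([:0, 1:] * \<phi> * pderiv \<xi>) n = of_nat n * (- \<rho>) * ?q n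
        + of_int (int n - 1) * (if n = 0 then 0 else ?q (n - 1))"
    proof -
      have "[:0, 1:] * \<phi> * pderiv \<xi> = \<phi> * ([:0, 1:] * pderiv \<xi>)"
        by (simp only: ac_simps)
      then show ?thesis
        unfolding \<phi>_def by (simp only: coeff_linear_mult coeff_X_pderiv) (cases n; simp add: algebra_simps)
    qed
    have 2: "coeff ([:0, 1:] ^ N * \<phi> ^ (b - 1)) n = (if n < N then 0 else B (n - N))"
      unfolding B[symmetric] by (simp add: coeff_monom_mult flip: monom_altdef[of 1 N, simplified])
    have 3: "coeff ([:0, 1:] * \<xi>) n = (if n = 0 then 0 else ?q (n - 1))"
      by (cases n) simp_all
    have "coeff (of_int (e - int N * D) * (\<phi> * \<xi>) + of_int D * ([:0, 1:] * \<phi> * pderiv \<xi>)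
      - of_int ((int b - 2) * D + e + e') * ([:0, 1:] * \<xi>)) n =
      of_int (e - int N * D) * ((if n = 0 then 0 else ?q (n - 1)) - \<rho> * ?q n)
      + of_int D * (of_nat n * (- \<rho>) * ?q n + of_int (int n - 1) * (if n = 0 then 0 else ?q (n - 1)))
      - of_int ((int b - 2) * D + e + e') * (if n = 0 then 0 else ?q (n - 1))"
      unfolding coeff_diff coeff_add coeff_of_int_mult
        1 3 unfolding \<phi>_def coeff_linear_mult ..
    also have "\<dots> = -\<rho> * of_int (e + (int n - int N) * D) * ?q n
      - of_int ((int b - 1 - (int n - int N)) * D + e') * (if n = 0 then 0 else ?q (n - 1))"
      by (simp add: algebra_simps)
    finally show ?thesis
      unfolding ode coeff_smult 2 by simp
  qed
  \<comment> \<open>Upward from n = 0: below N the right side vanishes, and the factor e + (n - N) D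
    is at most e - D < 0.\<close>
  have low: "?q n = 0" if "e < D" "n < N" for n
    using that(2)
  proof (induction n)
    case 0
    have "int N * D \<ge> 1 * D"
      using 0 assms(2) by (intro mult_right_mono) auto
    moreover have "(int 0 - int N) * D = - (int N * D)" by simp
    ultimately have "e + (int 0 - int N) * D \<noteq> 0"
      using that(1) by linarith
    then have "(of_int (e + (int 0 - int N) * D) :: 'a) \<noteq> 0"
      by (simp only: of_int_eq_0_iff not_False_eq_True)
    then show ?case
      using rec[of 0] 0 assms(7) by (simp del: of_int_add of_int_mult of_int_diff)
  next
    case (Suc n)
    have "(int N - int (Suc n)) * D \<ge> 1 * D"
      using Suc assms(2) by (intro mult_right_mono) auto
    moreover have "(int (Suc n) - int N) * D = - ((int N - int (Suc n)) * D)" by (simp add: algebra_simps)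
    ultimately have "e + (int (Suc n) - int N) * D \<noteq> 0"
      using that(1) by linarith
    then have "(of_int (e + (int (Suc n) - int N) * D) :: 'a) \<noteq> 0"
      by (simp only: of_int_eq_0_iff not_False_eq_True)
    then show ?case
      using rec[of "Suc n"] Suc assms(7) by (simp del: of_int_add of_int_mult of_int_diff of_nat_Suc)
  qed
  \<comment> \<open>Downward from beyond the degree: in the relation for n + 1 the right side
    vanishes and the factor of \<open>?q n\<close> is at most e' - D < 0.\<close>
  have high: "?q n = 0" if "e' < D" "n \<ge> N + b - 1" for n
  proof (cases "n > degree \<xi>")
    case True
    then show ?thesis by (rule coeff_eq_0)
  next
    case False
    then have "n \<le> Suc (degree \<xi>)" by simp
    then show ?thesis
      using that(2)
    proof (induction n rule: inc_induct)
      case base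
      show ?case by (simp add: coeff_eq_0)
    next
      case (step n)
      then have 0: "?q (Suc n) = 0" by simp
      have "(int b - 1 - (int (Suc n) - int N)) * D \<le> (-1) * D"
        using step assms(2,6) by (intro mult_right_mono) auto
      then have "(int b - 1 - (int (Suc n) - int N)) * D + e' \<noteq> 0"
        using that(1) by auto
      then have "(of_int ((int b - 1 - (int (Suc n) - int N)) * D + e') :: 'a) \<noteq> 0"
        by (simp only: of_int_eq_0_iff not_False_eq_True)
      moreover have "B (Suc n - N) = 0"
        using step assms(6) by (simp add: B_def binomial_eq_0)
      then have "c * (if Suc n < N then 0 else B (Suc n - N)) = 0" by simp
      then have "of_int ((int b - 1 - (int (Suc n) - int N)) * D + e') * ?q n = 0"
        using rec[of "Suc n"] unfolding 0 by (simp only: mult_zero_right diff_0 neg_equal_0_iff_equal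
            nat.distinct if_False diff_Suc_1 refl)
      ultimately show ?case
        by (simp only: mult_eq_0_iff simp_thms)
    qed
  qed
  consider "e = 0" | "e' = 0" | "e > 0" "e' > 0"
    using assms by linarith
  then show False
  proof cases
    \<comment> \<open>At n = N both terms on the left vanish, while the right side is c
      \<open>B 0\<close>, which is nonzero.\<close>
    case 1
    then have *: "(if N = 0 then 0 else ?q (N - 1)) = 0"
      using low[of "N - 1"] assms(2) by (cases "N = 0") auto
    show False
      using rec[of N, unfolded *] 1 assms(7,8) by (simp add: B_def)
  next
    \<comment> \<open>At n = N + b - 1 the factor of \<open>?q (n - 1)\<close> is e' = 0 and
      \<open>?q n\<close> vanishes by \<open>high\<close>, yet the right side is c.\<close>
    case 2
    have "?q (N + b - 1) = 0"
      using high[of "N + b - 1"] 2 assms(2) by auto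
    moreover have "int b - 1 - (int (N + b - 1) - int N) = 0" using assms(6) by simp
    moreover have "\<not> N + b - 1 < N" "N + b - 1 - N = b - 1" using assms(6) by auto
    ultimately show False
      using rec[of "N + b - 1"] 2 assms(8) by (simp add: B_def del: of_nat_diff)
  next
    case 3
    \<comment> \<open>Scaling by powers of -\<rho> and splitting off \<open>C\<close> removes \<rho>
      from the recursion and leaves rational coefficients.\<close>
    define s where "s j = (-\<rho>) ^ j * ?q (N + j)" for j
    define C where "C = c * (-\<rho>) ^ (b - 2)"
    have C: "C \<noteq> 0" using assms(7,8) by (simp add: C_def)
    have eD: "e < D" "e' < D" using 3 assms by auto
    have pow: "(-\<rho>) ^ j * B j = - \<rho> * (of_nat ((b - 1) choose j) * (-\<rho>) ^ (b - 2))" if "j \<le> b - 1" for j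
    proof -
      have 1: "(-\<rho>) ^ j * (-\<rho>) ^ (b - 1 - j) = (-\<rho>) ^ Suc (b - 2)"
        using that assms(6) unfolding power_add[symmetric] by (intro arg_cong[where f = "\<lambda>n. (-\<rho>) ^ n"]) auto
      have "(-\<rho>) ^ j * B j = of_nat ((b - 1) choose j) * ((-\<rho>) ^ j * (-\<rho>) ^ (b - 1 - j))"
        unfolding B_def by (rule mult.left_commute)
      then show ?thesis unfolding 1 power_Suc by (simp only: mult.left_commute)
    qed
    have rec0: "of_int e * s 0 = C"
    proof -
      have *: "(if N = 0 then 0 else ?q (N - 1)) = 0" using low[of "N - 1"] eD by (cases "N = 0") auto
      have "-\<rho> * (of_int e * ?q N) = c * B 0" using rec[of N, unfolded *] by (simp add: mult.assoc)
      then have "-\<rho> * (of_int e * s 0) = -\<rho> * C"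
        using pow[of 0] by (simp add: s_def C_def algebra_simps)
      then show ?thesis using assms(7) by simp
    qed
    have recS: "of_int (e + int (Suc j) * D) * s (Suc j) =
      of_int ((int b - 1 - int (Suc j)) * D + e') * s j + of_nat ((b - 1) choose Suc j) * C"
      if j: "Suc j \<le> b - 1" for j
    proof -
      let ?x = "of_int (e + int (Suc j) * D) :: 'a" and ?y = "of_int ((int b - 1 - int (Suc j)) * D + e') :: 'a"
      have *: "int (N + Suc j) - int N = int (Suc j)" by simp
      have "-\<rho> * ?x * ?q (N + Suc j) - ?y * ?q (N + j) = c * B (Suc j)"
        using rec[of "N + Suc j", unfolded *] by (simp del: of_int_add of_int_mult of_int_diff of_nat_Suc)
      then have "(-\<rho>) ^ Suc j * (-\<rho> * ?x * ?q (N + Suc j) - ?y * ?q (N + j)) = c * ((-\<rho>) ^ Suc j * B (Suc j))"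
        by (simp only: mult.left_commute)
      then have "-\<rho> * (?x * s (Suc j) - ?y * s j) = -\<rho> * (of_nat ((b - 1) choose Suc j) * C)"
        unfolding pow[OF j] s_def C_def by (simp only: power_Suc ring_distribs ac_simps)
      then have "?x * s (Suc j) - ?y * s j = of_nat ((b - 1) choose Suc j) * C"
        using assms(7) by (simp only: mult_cancel_left neg_equal_0_iff_equal simp_thms)
      then show ?thesis by (simp only: diff_eq_eq add.commute)
    qed
    have pos: "\<exists>x>0. s j = C * of_rat x" if "j \<le> b - 2" for j
      using that
    proof (induction j)
      case 0
      have "s 0 = C * of_rat (1 / of_int e)"
        using rec0 3(1) by (simp add: of_rat_divide field_simps)
      moreover have "0 < (1 / of_int e :: rat)" using 3(1) by simp
      ultimately show ?case by blast
    next
      case (Suc j)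
      then obtain x where x: "x > 0" "s j = C * of_rat x" by auto
      define u v where "u = e + int (Suc j) * D" and "v = (int b - 1 - int (Suc j)) * D + e'"
      have u: "u > 0" unfolding u_def using 3(1) assms(2) by (simp add: add_pos_nonneg)
      have v: "v > 0" unfolding v_def using 3(2) assms(2) Suc.prems by (simp add: add_nonneg_pos)
      define y where "y = (of_int v * x + of_nat ((b - 1) choose Suc j)) / (of_int u :: rat)"
      have "of_int u * s (Suc j) = C * (of_int v * of_rat x + of_nat ((b - 1) choose Suc j))"
        using recS[of j] Suc.prems unfolding u_def[symmetric] v_def[symmetric] x(2) by (simp add: algebra_simps)
      then have "s (Suc j) = C * of_rat y"
        using u by (simp add: y_def of_rat_divide of_rat_add of_rat_mult field_simps)
      moreover have "y > 0"
        unfolding y_def using u v x(1) by (intro divide_pos_pos add_pos_nonneg) auto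
      ultimately show ?case by blast
    qed
    \<comment> \<open>In the relation of index b - 1 the term \<open>s (Suc j)\<close> vanishes by
      \<open>high\<close>, which forces e' x + 1 = 0 with e' and x positive.\<close>
    obtain j where j: "b = Suc (Suc j)" using assms(6) by (metis Suc_le_D numeral_2_eq_2 Suc_le_mono)
    obtain x where x: "x > 0" "s j = C * of_rat x" using pos[of j] j by auto
    have "s (Suc j) = 0"
      using high[of "N + Suc j"] eD j by (simp add: s_def)
    then have "C * (of_int e' * of_rat x + 1) = 0"
      using recS[of j] x(2) j by (simp add: algebra_simps)
    then have "of_rat (of_int e' * x + 1) = (0 :: 'a)"
      using C by (simp add: of_rat_add of_rat_mult)
    then have "of_int e' * x + 1 = 0" by simp
    moreover have "of_int e' * x > 0" using 3 x by simp
    ultimately show False by simp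
  qed
qed

section \<open>Derivation rules for the bracket\<close>

lemma pderiv_sum: "pderiv (sum f A) = (\<Sum>x\<in>A. pderiv (f x))"
  using higher_pderiv_sum[where n = 1] by simp

lemma pderiv_x_mult: "pderiv_x (f * g) = pderiv_x f * g + f * pderiv_x g"
  for f g :: "'a::field poly poly"
  by (rule poly_eqI)
     (simp add: pderiv_x_def coeff_map_poly coeff_mult pderiv_sum pderiv_mult sum.distrib add.commute
      mult.commute[of "coeff g _"])

lemma pderiv_x_diff: "pderiv_x (f - g) = pderiv_x f - pderiv_x g"
  for f g :: "'a::field poly poly"
  by (rule poly_eqI) (simp add: pderiv_x_def coeff_map_poly pderiv_diff)

lemma bracket_mult: "jacobian_bracket f (g * h) = jacobian_bracket f g * h + g * jacobian_bracket f h"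
  for f g h :: "'a::field poly poly"
  by (simp add: jacobian_bracket_def pderiv_x_mult pderiv_y_def pderiv_mult algebra_simps)

lemma bracket_diff: "jacobian_bracket f (g - h) = jacobian_bracket f g - jacobian_bracket f h"
  for f g h :: "'a::field poly poly"
  by (simp add: jacobian_bracket_def pderiv_x_diff pderiv_y_def pderiv_diff algebra_simps)

lemma bracket_const: "jacobian_bracket f [:[:c:]:] = 0"
  for f :: "'a::field poly poly"
  by (simp add: jacobian_bracket_def pderiv_x_def pderiv_y_def map_poly_pCons pderiv_pCons)

lemma bracket_self: "jacobian_bracket f f = 0"
  by (simp add: jacobian_bracket_def)

lemma bracket_one: "jacobian_bracket f 1 = 0"
  using bracket_const[of f 1] by (simp add: one_pCons)

lemma bracket_power_self: "jacobian_bracket f (f ^ n) = 0"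
  by (induction n) (simp_all add: bracket_mult bracket_self bracket_one)

lemma bracket_const_mult: "jacobian_bracket f ([:[:c:]:] * g) = [:[:c:]:] * jacobian_bracket f g"
  unfolding bracket_mult bracket_const by simp

section \<open>Reduction of the leading form\<close>

context edge_direction
begin

text \<open>A constant has weight 0, whereas the bracket of the leading forms would have weight (2 +
  b) D - (m2 - m1) > 0; so they commute. Their starts 2 v and b v are parallel, the determinant term
  drops, and 2 f g' = b f' g remains. This makes f a square, and inserting it gives \<phi> g' = b
  g.\<close>

lemma leading_square:
  fixes F G :: "'a::{alg_closed_field, field_char_0} poly poly"
  assumes F: "starts_at F (2 * v1) (2 * v2)" and G: "starts_at G (int b * v1) (int b * v2)"
    and D: "wt v1 v2 = D" "D > 0" "m2 - m1 \<le> D" and "odd b"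
    and degree: "degree (edge_poly F (2 * v1) (2 * v2)) = 2"
    and F0: "icoeff F (2 * v1) (2 * v2) \<noteq> 0" and G0: "icoeff G (int b * v1) (int b * v2) \<noteq> 0"
    and bracket: "jacobian_bracket F G = [:[:c:]:]"
  obtains \<rho> \<gamma> \<gamma>' where "\<rho> \<noteq> 0" "\<gamma> \<noteq> 0" "\<gamma>' \<noteq> 0"
    "edge_poly F (2 * v1) (2 * v2) = smult \<gamma> ([:-\<rho>, 1:]\<^sup>2)"
    "edge_poly G (int b * v1) (int b * v2) = smult \<gamma>' ([:-\<rho>, 1:] ^ b)"
proof -
  define f g where "f = edge_poly F (2 * v1) (2 * v2)" and "g = edge_poly G (int b * v1) (int b * v2)"
  let ?r = "2 * v1 + int b * v1 - 1" and ?s = "2 * v2 + int b * v2 - 1"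
  have "wt ?r ?s = (2 + int b) * D - (m2 - m1)"
    unfolding D(1)[symmetric] by (simp add: wt_def algebra_simps)
  moreover have "(2 + int b) * D \<ge> 2 * D"
    using D by (intro mult_right_mono) auto
  ultimately have "0 < wt ?r ?s"
    using D by linarith
  moreover have "bounded_by [:[:c:]:] 0"
    by (auto simp: bounded_by_def icoeff_const wt_def split: if_splits)
  ultimately have "edge_poly (jacobian_bracket F G) ?r ?s = 0"
    unfolding bracket using edge_poly_eq_0 by blast
  moreover have "wt (2 * v1) (2 * v2) = 2 * D" "wt (int b * v1) (int b * v2) = int b * D"
    by (simp_all add: wt_scale D)
  ultimately have "of_int (2 * D) * ([:0, 1:] * f * pderiv g) - of_int (int b * D) * ([:0, 1:] * pderiv f * g) = 0"
    using edge_poly_bracket[OF F G] by (simp add: f_def g_def algebra_simps)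
  then have "of_int D * [:0, 1:] * (of_nat 2 * (f * pderiv g) - of_nat b * (pderiv f * g)) = 0"
    by (simp only: of_int_mult of_int_of_nat_eq right_diff_distrib ac_simps of_int_numeral of_nat_numeral)
  moreover have "of_int D * [:0, 1 :: 'a:] \<noteq> 0"
    using D(2) by (simp only: mult_eq_0_iff of_int_poly_eq_0_iff pCons_eq_0_iff) simp
  ultimately have ode: "of_nat 2 * (f * pderiv g) = of_nat b * (pderiv f * g)"
    by (metis mult_eq_0_iff right_minus_eq)
  have f0: "coeff f 0 \<noteq> 0" and g0: "coeff g 0 \<noteq> 0"
    using F0 G0 by (simp_all add: f_def g_def coeff_edge_poly)
  then have "g \<noteq> 0" by auto
  then obtain \<rho> \<gamma> where \<rho>: "\<rho> \<noteq> 0" "\<gamma> \<noteq> 0" "f = smult \<gamma> ([:-\<rho>, 1:]\<^sup>2)"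
    using quadratic_is_square[OF degree[folded f_def] f0 _ \<open>odd b\<close> ode] by blast
  define \<phi> where "\<phi> = [:-\<rho>, 1:]"
  have "pderiv \<phi> = 1" by (simp add: \<phi>_def pderiv_pCons)
  then have "pderiv f = smult (2 * \<gamma>) \<phi>"
    unfolding \<rho>(3) \<phi>_def[symmetric] by (simp add: pderiv_smult power2_eq_square pderiv_mult numeral_poly ac_simps)
  with ode have "smult (2 * \<gamma>) \<phi> * (\<phi> * pderiv g) = smult (2 * \<gamma>) \<phi> * (of_nat b * g)"
    unfolding \<rho>(3) \<phi>_def[symmetric] by (simp add: power2_eq_square of_nat_poly ac_simps)
  moreover have "smult (2 * \<gamma>) \<phi> \<noteq> 0"
    using \<rho>(2) by (simp add: \<phi>_def)
  ultimately have "\<phi> * pderiv g = of_nat b * g"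
    by (simp only: mult_cancel_left simp_thms)
  \<comment> \<open>The equation of \<open>commuting_with_linear_power\<close> with E = 0, D = 1 and
    k = b.\<close>
  then have ode': "of_int 0 * (\<phi> * g) + of_int 1 * ([:0, 1:] * \<phi> * pderiv g) - of_int (int b) * ([:0, 1:] * g) = 0"
    by (simp only: mult.assoc) (simp add: of_nat_poly)
  then obtain n \<kappa> where "\<kappa> \<noteq> 0" "g = smult \<kappa> (\<phi> ^ n)" "int b = int n * 1"
    using commuting_with_linear_power[OF zero_less_one \<rho>(1) g0 ode'[unfolded \<phi>_def]]
    unfolding \<phi>_def by metis
  then show thesis
    using that[of \<rho> \<gamma> \<kappa>] \<rho> by (auto simp: f_def g_def \<phi>_def)
qed

text \<open>The weight does not vanish on v, so it determines a multiple of v.\<close>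

lemma parallel_to_vertex:
  assumes "r * v2 = v1 * s" "wt r s = n * wt v1 v2" "wt v1 v2 \<noteq> 0"
  shows "r = n * v1" "s = n * v2"
proof -
  have "wt v1 v2 * r = wt r s * v1"
    using assms(1) by (simp add: wt_def algebra_simps)
  also have "\<dots> = wt v1 v2 * (n * v1)"
    unfolding assms(2) by (simp add: algebra_simps)
  finally show "r = n * v1" using assms(3) by simp
  have "wt v1 v2 * s = wt r s * v2"
    using assms(1) by (simp add: wt_def algebra_simps)
  also have "\<dots> = wt v1 v2 * (n * v2)"
    unfolding assms(2) by (simp add: algebra_simps)
  finally show "s = n * v2" using assms(3) by simp
qed

text \<open>\<open>m2 - m1\<close> is the weight of (1, 1), and \<open>cone\<close> puts (1, 1)
  between the rays through v and v + m.\<close>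

theorem bracket_zero_of_edge:
  fixes F G :: "'a::{alg_closed_field, field_char_0} poly poly"
  assumes F: "starts_at F (2 * v1) (2 * v2)" and G: "starts_at G (int b * v1) (int b * v2)"
    and D: "wt v1 v2 = D" "D > 0" "m2 - m1 \<le> D" and b: "odd b" "b \<ge> 3"
    and cone: "v2 \<le> v1" "v1 + m1 \<le> v2 + m2"
    and degree: "degree (edge_poly F (2 * v1) (2 * v2)) = 2"
    and F0: "icoeff F (2 * v1) (2 * v2) \<noteq> 0" and G0: "icoeff G (int b * v1) (int b * v2) \<noteq> 0"
    and bracket: "jacobian_bracket F G = [:[:c:]:]"
  shows "c = 0"
proof (rule ccontr)
  assume "c \<noteq> 0"
  obtain \<rho> \<gamma> \<gamma>' where \<rho>: "\<rho> \<noteq> 0" "\<gamma> \<noteq> 0" "\<gamma>' \<noteq> 0"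
    and edge_F': "edge_poly F (2 * v1) (2 * v2) = smult \<gamma> ([:-\<rho>, 1:]\<^sup>2)"
    and edge_G': "edge_poly G (int b * v1) (int b * v2) = smult \<gamma>' ([:-\<rho>, 1:] ^ b)"
    using leading_square[OF F G D b(1) degree F0 G0 bracket] .
  define \<phi> where "\<phi> = [:-\<rho>, 1:]"
  note edge_F = edge_F'[folded \<phi>_def] and edge_G = edge_G'[folded \<phi>_def]
  have "\<phi> \<noteq> 0" "pderiv \<phi> = 1" by (simp_all add: \<phi>_def pderiv_pCons)
  then have pderiv_F: "pderiv (smult \<gamma> (\<phi>\<^sup>2)) = smult (2 * \<gamma>) \<phi>"
    by (simp add: pderiv_smult power2_eq_square pderiv_mult numeral_poly ac_simps)
  have wt_F: "wt (2 * v1) (2 * v2) = 2 * D" and wt_G: "wt (int b * v1) (int b * v2) = int b * D"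
    by (simp_all add: wt_scale D)
  \<comment> \<open>The leading form of F is \<gamma> H^2, so bracketing with it is 2 \<gamma> H
    times bracketing with H.\<close>
  have bracket_F: "edge_poly (jacobian_bracket F Q) (2 * v1 + r - 1) (2 * v2 + s - 1) =
      smult (2 * \<gamma>) \<phi> * (of_int (v1 * s - r * v2) * (\<phi> * edge_poly Q r s)
        + of_int D * ([:0, 1:] * \<phi> * pderiv (edge_poly Q r s)) - of_int (wt r s) * ([:0, 1:] * edge_poly Q r s))"
    if "starts_at Q r s" for Q r s
  proof -
    have 1: "smult \<gamma> (\<phi>\<^sup>2) = [:\<gamma>:] * \<phi> * \<phi>" "smult (2 * \<gamma>) \<phi> = 2 * [:\<gamma>:] * \<phi>"
      by (simp_all add: power2_eq_square numeral_poly mult.commute[of \<gamma>])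
    have 2: "of_int (2 * v1 * s - r * (2 * v2)) = 2 * (of_int (v1 * s - r * v2) :: 'a poly)"
      "of_int (2 * D) = 2 * (of_int D :: 'a poly)"
      by (simp_all add: algebra_simps)
    show ?thesis
      unfolding edge_poly_bracket[OF F that] edge_F pderiv_F wt_F 2 unfolding 1
      by (simp only: ring_distribs ac_simps)
  qed
  \<comment> \<open>From this weight a bracket with F reaches exactly the weight of G: 2 D + L - (m2
    - m1) = b D.\<close>
  define L where "L = (int b - 2) * D + (m2 - m1)"
  have "m2 - m1 \<ge> 0" using cone by simp
  \<comment> \<open>The invariant of the reduction; T collects the brackets of the subtracted
    multiples of F^k G and stays below the leading form of G.\<close>
  define good where "good Q \<longleftrightarrow> (\<exists>T. jacobian_bracket F Q = [:[:c:]:] * (G + G - T) \<and> bounded_by T (int b * D - 1))"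
    for Q
  have bounded_G: "bounded_by G (int b * D)"
    using starts_at_imp_bounded[OF G] wt_G by simp
  have T_0: "bounded_by (0 :: 'a poly poly) k" for k
    by (simp add: bounded_by_def icoeff_def bicoeff_def)
  \<comment> \<open>Above weight L the bracket with F has smaller weight than expected, so the
    leading form of Q commutes with H. It is then a multiple of H^n and cancels against F^k or F^k
    G.\<close>
  have descend: "\<exists>Q'. good Q' \<and> bounded_by Q' (wt r s - 1)"
    if Q: "good Q" "starts_at Q r s" "icoeff Q r s \<noteq> 0" "L < wt r s" "wt r s \<le> 2 * int b * D" for Q r s
  proof -
    obtain T where T: "jacobian_bracket F Q = [:[:c:]:] * (G + G - T)" "bounded_by T (int b * D - 1)"
      using Q(1) unfolding good_def by blast
    have "bounded_by ([:[:c:]:] * (G + G - T)) (int b * D)"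
      by (intro bounded_const_mult bounded_diff bounded_add bounded_G bounded_mono[OF T(2)]) simp
    moreover have "wt (2 * v1 + r - 1) (2 * v2 + s - 1) > int b * D"
    proof -
      have "wt (2 * v1 + r - 1) (2 * v2 + s - 1) = 2 * D + wt r s - (m2 - m1)"
        unfolding wt_F[symmetric] by (simp add: wt_def algebra_simps)
      moreover have "2 * D + L - (m2 - m1) = int b * D" by (simp add: L_def algebra_simps)
      ultimately show ?thesis using Q(4) by linarith
    qed
    ultimately have "edge_poly (jacobian_bracket F Q) (2 * v1 + r - 1) (2 * v2 + s - 1) = 0"
      unfolding T(1) by (rule edge_poly_eq_0)
    moreover have "smult (2 * \<gamma>) \<phi> \<noteq> 0" using \<rho>(2) \<open>\<phi> \<noteq> 0\<close> by simp
    ultimately have ode: "of_int (v1 * s - r * v2) * (\<phi> * edge_poly Q r s)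
        + of_int D * ([:0, 1:] * \<phi> * pderiv (edge_poly Q r s)) - of_int (wt r s) * ([:0, 1:] * edge_poly Q r s) = 0"
      unfolding bracket_F[OF Q(2)] by (simp only: mult_eq_0_iff simp_thms)
    have "coeff (edge_poly Q r s) 0 \<noteq> 0" using Q(3) by (simp add: coeff_edge_poly)
    then obtain n \<kappa> where n: "v1 * s - r * v2 = 0" "\<kappa> \<noteq> 0" "edge_poly Q r s = smult \<kappa> (\<phi> ^ n)" "wt r s = int n * D"
      using commuting_with_linear_power[OF D(2) \<rho>(1) _ ode[unfolded \<phi>_def]] unfolding \<phi>_def by blast
    have "r * v2 = v1 * s" "wt r s = int n * wt v1 v2" "wt v1 v2 \<noteq> 0"
      using n(1,4) D by simp_all
    note rs = parallel_to_vertex[OF this]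
    have "int n * D \<le> 2 * int b * D" using Q(5) n(4) by simp
    then have n_le: "n \<le> 2 * b" using D(2) by simp
    have "(int b - 2) * D < int n * D"
      using Q(4) n(4) \<open>m2 - m1 \<ge> 0\<close> by (simp add: L_def)
    then have n_ge: "n \<ge> b - 1" using D(2) b by simp
    \<comment> \<open>Since n >= b - 1 and b - 1 is even, an odd n is at least b, so
      \<open>n - b\<close> is not truncated.\<close>
    define k where "k = (if even n then n div 2 else (n - b) div 2)"
    define H where "H = (if even n then F ^ k else F ^ k * G)"
    have n_eq: "n = (if even n then 2 * k else 2 * k + b)"
      using n_ge b unfolding k_def by (cases "even n") (presburger+)
    have Fk: "starts_at (F ^ k) (int (2 * k) * v1) (int (2 * k) * v2)"
      "edge_poly (F ^ k) (int (2 * k) * v1) (int (2 * k) * v2) = smult (\<gamma> ^ k) (\<phi> ^ (2 * k))"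
    proof -
      have *: "int k * (2 * v) = int (2 * k) * v" for v by simp
      show "starts_at (F ^ k) (int (2 * k) * v1) (int (2 * k) * v2)"
        using starts_at_power(1)[OF F, of k] unfolding * .
      show "edge_poly (F ^ k) (int (2 * k) * v1) (int (2 * k) * v2) = smult (\<gamma> ^ k) (\<phi> ^ (2 * k))"
        using starts_at_power(2)[OF F, of k] unfolding * edge_F by (simp add: smult_power power_mult)
    qed
    have "\<exists>\<mu>. \<mu> \<noteq> 0 \<and> starts_at H r s \<and> edge_poly H r s = smult \<mu> (\<phi> ^ n)"
    proof (cases "even n")
      case True
      then show ?thesis
        using Fk \<rho>(2) n_eq unfolding H_def rs by (intro exI[of _ "\<gamma> ^ k"]) simp
    next
      case False
      then have *: "n = 2 * k + b" using n_eq by simp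
      have sum: "int (2 * k) * v + int b * v = int n * v" for v unfolding * by (simp add: algebra_simps)
      have "starts_at (F ^ k * G) r s"
        using starts_at_mult[OF Fk(1) G] unfolding sum rs .
      moreover have "edge_poly (F ^ k * G) r s = smult (\<gamma> ^ k * \<gamma>') (\<phi> ^ n)"
        using edge_poly_mult[OF Fk(1) G] unfolding sum rs Fk(2) edge_G by (simp add: * power_add ac_simps)
      ultimately have "starts_at (F ^ k * G) r s" "edge_poly (F ^ k * G) r s = smult (\<gamma> ^ k * \<gamma>') (\<phi> ^ n)"
        by simp_all
      then show ?thesis
        using False \<rho>(2,3) unfolding H_def by (intro exI[of _ "\<gamma> ^ k * \<gamma>'"]) simp
    qed
    then obtain \<mu> where \<mu>: "\<mu> \<noteq> 0" "starts_at H r s" "edge_poly H r s = smult \<mu> (\<phi> ^ n)" by blast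
    define Q' where "Q' = Q - [:[:\<kappa> / \<mu>:]:] * H"
    have "starts_at Q' r s"
      unfolding Q'_def by (intro starts_at_diff starts_at_const_mult Q(2) \<mu>(2))
    moreover have "edge_poly Q' r s = 0"
      using \<mu>(1) unfolding Q'_def edge_poly_diff edge_poly_const_mult n(3) \<mu>(3) by simp
    ultimately have "bounded_by Q' (wt r s - 1)"
      by (rule bounded_less)
    moreover have "good Q'"
    proof (cases "even n")
      case True
      then have "jacobian_bracket F Q' = jacobian_bracket F Q"
        unfolding Q'_def H_def bracket_diff bracket_const_mult by (simp add: bracket_power_self)
      then show ?thesis using T unfolding good_def by auto
    next
      \<comment> \<open>[F, F^k G] = c F^k enters T. As n is odd, n < 2 b and hence 2 k < b, which
        keeps this term below weight b D.\<close>
      case False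
      then have "jacobian_bracket F H = F ^ k * [:[:c:]:]"
        unfolding H_def by (simp add: bracket_mult bracket_power_self bracket del: mult_pCons_right)
      then have "jacobian_bracket F Q' = [:[:c:]:] * (G + G - (T + [:[:\<kappa> / \<mu>:]:] * F ^ k))"
        unfolding Q'_def bracket_diff bracket_const_mult T(1) by (simp only: ring_distribs ac_simps diff_diff_add)
      moreover have "bounded_by (F ^ k) (int b * D - 1)"
      proof -
        have "bounded_by (F ^ k) (int (2 * k) * D)"
          using starts_at_imp_bounded[OF Fk(1)] by (simp only: wt_scale D)
        moreover have "2 * k \<le> b - 1"
        proof -
          have "n \<noteq> 2 * b" using False by auto
          then show ?thesis using n_eq False n_le by simp
        qed
        then have "int (2 * k) * D \<le> (int b - 1) * D"
          using D(2) b by (intro mult_right_mono) auto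
        then have "int (2 * k) * D \<le> int b * D - 1"
          using D(2) by (simp add: algebra_simps)
        ultimately show ?thesis by (rule bounded_mono)
      qed
      ultimately show ?thesis
        unfolding good_def using T(2) by (blast intro: bounded_add bounded_const_mult)
    qed
    ultimately show ?thesis by blast
  qed
  have reduce: "\<exists>Q. good Q \<and> bounded_by Q L"
    if "good Q" "bounded_by Q (L + int n)" "L + int n \<le> 2 * int b * D" for n Q
    using that
  proof (induction n arbitrary: Q)
    case 0
    then show ?case by auto
  next
    case (Suc n)
    have "\<exists>Q'. good Q' \<and> bounded_by Q' (L + int n)"
    proof (cases "\<exists>i j. icoeff Q i j \<noteq> 0 \<and> wt i j = L + int (Suc n)")
      case True
      then obtain r s where rs: "starts_at Q r s" "icoeff Q r s \<noteq> 0" "wt r s = L + int (Suc n)"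
        using starts_at_exact[OF Suc.prems(2)] by blast
      then show ?thesis
        using descend[OF Suc.prems(1) rs(1,2)] Suc.prems(3) by simp
    next
      case False
      then have "bounded_by Q (L + int n)"
        using Suc.prems(2) unfolding bounded_by_def by force
      then show ?thesis using Suc.prems(1) by blast
    qed
    then show ?case using Suc.IH Suc.prems(3) by auto
  qed
  have "jacobian_bracket F (G * G) = [:[:c:]:] * (G + G - 0)"
    unfolding bracket_mult bracket by (simp only: ring_distribs ac_simps mult_zero_right diff_zero)
  then have "good (G * G)"
    unfolding good_def using T_0 by blast
  moreover have "L = D * int b - 2 * D + (m2 - m1)" "2 * int b * D = 2 * (D * int b)" "0 \<le> D * int b"
    using D(2) by (simp_all add: L_def algebra_simps)
  then have "L \<le> 2 * int b * D"
    using D(2,3) by linarith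
  then have "L + int (nat (2 * int b * D - L)) = 2 * int b * D" by simp
  moreover have "bounded_by (G * G) (2 * int b * D)"
    using bounded_mult[OF bounded_G bounded_G] by (simp add: algebra_simps)
  ultimately obtain Q where Q: "good Q" "bounded_by Q L"
    using reduce[of "G * G" "nat (2 * int b * D - L)"] by auto
  \<comment> \<open>The point (b - 2) v + (1, 1) has weight L, and bracketing from the starts 2 v
    and (r, s) lands on b v, the start of G. Going back N steps catches the whole leading form of
    Q.\<close>
  define r s where "r = (int b - 2) * v1 + 1" and "s = (int b - 2) * v2 + 1"
  have wt_rs: "wt r s = L"
    unfolding L_def r_def s_def D(1)[symmetric] by (simp add: wt_def algebra_simps)
  obtain N where N: "starts_at Q (r - int N * m1) (s - int N * m2)"
    using starts_at_below[of Q r s] Q(2) wt_rs by blast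
  define \<xi> where "\<xi> = edge_poly Q (r - int N * m1) (s - int N * m2)"
  obtain T where T: "jacobian_bracket F Q = [:[:c:]:] * (G + G - T)" "bounded_by T (int b * D - 1)"
    using Q(1) unfolding good_def by blast
  let ?r = "int b * v1 - int N * m1" and ?s = "int b * v2 - int N * m2"
  have "edge_poly G ?r ?s = [:0, 1:] ^ N * smult \<gamma>' (\<phi> ^ b)"
    using edge_poly_shift(2)[OF G, of N] edge_G by simp
  moreover have "edge_poly T ?r ?s = 0"
    using edge_poly_eq_0[OF T(2), of ?r ?s] wt_G by simp
  moreover have "edge_poly (G + G - T) ?r ?s = edge_poly G ?r ?s + edge_poly G ?r ?s - edge_poly T ?r ?s"
    by (rule poly_eqI) (simp only: coeff_edge_poly icoeff_add icoeff_diff coeff_add coeff_diff)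
  ultimately have "edge_poly (jacobian_bracket F Q) ?r ?s = smult (2 * c * \<gamma>') ([:0, 1:] ^ N * \<phi> ^ b)"
    unfolding T(1) edge_poly_const_mult by (simp add: ac_simps flip: smult_add_left)
  moreover have "?r = 2 * v1 + (r - int N * m1) - 1" "?s = 2 * v2 + (s - int N * m2) - 1"
    by (simp_all add: r_def s_def algebra_simps)
  moreover have "v1 * (s - int N * m2) - (r - int N * m1) * v2 = v1 - v2 - int N * D"
    unfolding r_def s_def D(1)[symmetric] wt_def by (simp add: algebra_simps)
  moreover have "wt (r - int N * m1) (s - int N * m2) = (int b - 2) * D + (v1 - v2) + (v2 + m2 - (v1 + m1))"
    using wt_rs by (simp add: L_def)
  \<comment> \<open>T has no part of weight b D, so the top part of [F, Q] is 2 c times that of G.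
    The numbers e = v1 - v2 and e' = v2 + m2 - (v1 + m1) are nonnegative by \<open>cone\<close>, and
    their sum m2 - m1 is at most D.\<close>
  ultimately have eq: "smult (2 * \<gamma>) \<phi> * (of_int (v1 - v2 - int N * D) * (\<phi> * \<xi>)
        + of_int D * ([:0, 1:] * \<phi> * pderiv \<xi>)
        - of_int ((int b - 2) * D + (v1 - v2) + (v2 + m2 - (v1 + m1))) * ([:0, 1:] * \<xi>)) =
      smult (2 * c * \<gamma>') ([:0, 1:] ^ N * \<phi> ^ b)" (is "_ * ?A = _")
    using bracket_F[OF N] unfolding \<xi>_def by simp
  also have "\<dots> = smult (2 * \<gamma>) \<phi> * smult (c * \<gamma>' / \<gamma>) ([:0, 1:] ^ N * \<phi> ^ (b - 1))"
  proof -
    have "\<phi> ^ b = \<phi> * \<phi> ^ (b - 1)" using b by (cases b) auto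
    then show ?thesis using \<rho>(2) by (simp add: ac_simps)
  qed
  finally have "?A = smult (c * \<gamma>' / \<gamma>) ([:0, 1:] ^ N * \<phi> ^ (b - 1))"
    using \<rho>(2) \<open>\<phi> \<noteq> 0\<close> by (simp only: mult_cancel_left) simp
  then show False
    using no_edge_solution[of D "v1 - v2" "v2 + m2 - (v1 + m1)" b \<rho> "c * \<gamma>' / \<gamma>" N \<xi>]
      D b cone \<rho> \<open>c \<noteq> 0\<close> unfolding \<phi>_def by simp
qed

end

section \<open>Polynomials quadratic in one variable\<close>

text \<open>Monic in y up to a nonzero constant, so that completing the square in y needs no
  division by polynomials in x.\<close>

definition y_monic :: "'a::zero poly poly \<Rightarrow> nat \<Rightarrow> bool" where
  "y_monic f n \<longleftrightarrow> bicoeff f 0 n \<noteq> 0 \<and> (\<forall>i j. bicoeff f i j \<noteq> 0 \<longrightarrow> j < n \<or> (j = n \<and> i = 0))"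

lemma y_monicD:
  assumes "y_monic f n"
  shows "degree f = n" "\<exists>c. c \<noteq> 0 \<and> coeff f n = [:c:]"
proof -
  have "coeff f n = [:bicoeff f 0 n:]"
    using assms by (intro poly_eqI) (auto simp: y_monic_def bicoeff_def coeff_pCons split: nat.splits)
  moreover have "bicoeff f 0 n \<noteq> 0" using assms by (simp add: y_monic_def)
  ultimately show "\<exists>c. c \<noteq> 0 \<and> coeff f n = [:c:]" by blast
  have "coeff f j = 0" if "j > n" for j
    using assms that by (intro poly_eqI) (force simp: y_monic_def bicoeff_def)
  then have "degree f \<le> n" by (intro degree_le) auto
  moreover have "n \<le> degree f"
    using \<open>coeff f n = _\<close> \<open>bicoeff f 0 n \<noteq> 0\<close> by (intro le_degree) auto
  ultimately show "degree f = n" by simp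
qed

lemma pderiv_x_add: "pderiv_x (f + g) = pderiv_x f + pderiv_x g"
  for f g :: "'a::field poly poly"
  by (rule poly_eqI) (simp add: pderiv_x_def coeff_map_poly pderiv_add)

lemma pderiv_x_pCons: "pderiv_x (pCons p f) = pCons (pderiv p) (pderiv_x f)"
  by (simp add: pderiv_x_def map_poly_pCons)

lemma pderiv_x_0: "pderiv_x 0 = 0"
  by (simp add: pderiv_x_def)

text \<open>The chain rule for the substitution y -> y + u(x).\<close>

lemma pderiv_x_shift:
  fixes f :: "'a::field_char_0 poly poly"
  shows "pderiv_x (pcompose f [:u, 1:]) =
    pcompose (pderiv_x f) [:u, 1:] + pcompose (pderiv_y f) [:u, 1:] * [:pderiv u:]"
proof (induction f rule: pCons_induct)
  case 0
  show ?case by (simp add: pderiv_x_0 pderiv_y_def)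
next
  case (pCons p f)
  have "pderiv_x [:u, 1:] = [:pderiv u:]"
    by (simp add: pderiv_x_pCons pderiv_x_0)
  then have "pderiv_x (pcompose (pCons p f) [:u, 1:]) =
      [:pderiv p:] + ([:pderiv u:] * pcompose f [:u, 1:] + [:u, 1:] * pderiv_x (pcompose f [:u, 1:]))"
    unfolding pcompose_pCons pderiv_x_add pderiv_x_mult by (simp add: pderiv_x_pCons pderiv_x_0)
  also have "\<dots> = pcompose (pderiv_x (pCons p f)) [:u, 1:] + pcompose (pderiv_y (pCons p f)) [:u, 1:] * [:pderiv u:]"
    unfolding pCons pderiv_x_pCons pcompose_pCons pderiv_y_def pderiv_pCons pcompose_add
    by (simp only: pcompose_pCons ring_distribs ac_simps) simp
  finally show ?case .
qed

text \<open>The map (x, y) -> (x, y + u(x)) has Jacobian determinant 1: the terms with u'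
  cancel.\<close>

lemma bracket_shift:
  fixes f g :: "'a::field_char_0 poly poly"
  shows "jacobian_bracket (pcompose f [:u, 1:]) (pcompose g [:u, 1:]) = pcompose (jacobian_bracket f g) [:u, 1:]"
proof -
  have "pderiv_y (pcompose h [:u, 1:]) = pcompose (pderiv_y h) [:u, 1:]" for h :: "'a poly poly"
    by (simp add: pderiv_y_def pderiv_pcompose pderiv_pCons)
  then show ?thesis
    unfolding jacobian_bracket_def pderiv_x_shift by (simp only: pcompose_diff pcompose_mult) (simp only: ring_distribs ac_simps, simp)
qed

text \<open>Let g_n be the coefficient of y^n in G. The bracket gives q' g_1 = c, and (n + 1) q'
  g_(n+1) = 2 f g_(n-1)' for n > 0. Descending by twos from g_b, each integration raises the degree
  in x by at least one, so neither g_1 nor q' g_1 is constant.\<close>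

lemma bracket_zero_completed_square:
  fixes G :: "'a::field_char_0 poly poly"
  assumes "f \<noteq> 0" "degree G = b" "coeff G b = [:g:]" "g \<noteq> 0" "odd b" "b \<ge> 3"
    and bracket: "jacobian_bracket [:q, 0, [:f:]:] G = [:[:c:]:]"
  shows "c = 0"
proof (rule ccontr)
  assume "c \<noteq> 0"
  have eq: "pderiv q * (of_nat (Suc n) * coeff G (Suc n)) - (if n = 0 then 0 else smult (2 * f) (pderiv (coeff G (n - 1)))) =
    (if n = 0 then [:c:] else 0)" for n
  proof -
    have "jacobian_bracket [:q, 0, [:f:]:] G = [:pderiv q:] * pderiv G - [:[:2 * f:]:] * pCons 0 (pderiv_x G)"
      by (simp add: jacobian_bracket_def pderiv_x_pCons pderiv_x_0 pderiv_y_def pderiv_pCons)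
    then have "coeff (jacobian_bracket [:q, 0, [:f:]:] G) n =
       pderiv q * (of_nat (Suc n) * coeff G (Suc n)) - (if n = 0 then 0 else smult (2 * f) (pderiv (coeff G (n - 1))))"
      by (cases n) (simp_all add: coeff_pderiv pderiv_x_def coeff_map_poly)
    then show ?thesis unfolding bracket by (cases n) simp_all
  qed
  have q1: "pderiv q * coeff G 1 = [:c:]"
    using eq[of 0] by simp
  with \<open>c \<noteq> 0\<close> have q: "pderiv q \<noteq> 0" by auto
  have "coeff G (b - 2 * j) \<noteq> 0 \<and> j \<le> degree (coeff G (b - 2 * j))" if "2 * j < b" for j
    using that
  proof (induction j)
    case 0
    then show ?case using assms(3,4) by simp
  next
    case (Suc j)
    define n where "n = b - 2 * j - 1"
    have n: "n \<noteq> 0" "Suc n = b - 2 * j" "n - 1 = b - 2 * Suc j"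
      using Suc.prems by (simp_all add: n_def)
    have IH: "coeff G (Suc n) \<noteq> 0" "j \<le> degree (coeff G (Suc n))"
      using Suc unfolding n(2) by simp_all
    have "smult (2 * f) (pderiv (coeff G (n - 1))) = smult (of_nat (Suc n)) (pderiv q * coeff G (Suc n))"
      using eq[of n] n(1) by (simp add: of_nat_poly del: of_nat_Suc)
    then have "degree (smult (2 * f) (pderiv (coeff G (n - 1)))) = degree (smult (of_nat (Suc n)) (pderiv q * coeff G (Suc n)))"
      and "smult (2 * f) (pderiv (coeff G (n - 1))) \<noteq> 0"
      using q IH(1) by (simp_all del: of_nat_Suc)
    then have "degree (pderiv (coeff G (n - 1))) = degree (pderiv q) + degree (coeff G (Suc n))"
      "pderiv (coeff G (n - 1)) \<noteq> 0"
      using q IH(1) assms(1) by (simp_all add: degree_mult_eq del: of_nat_Suc)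
    then have "degree (coeff G (n - 1)) \<noteq> 0" "j \<le> degree (coeff G (n - 1)) - 1"
      using IH(2) by (simp_all add: pderiv_eq_0_iff degree_pderiv)
    then show ?case unfolding n(3)[symmetric] by auto
  qed
  \<comment> \<open>For j = (b - 1) / 2 the index b - 2 j is 1, and j >= 1 because b >= 3.\<close>
  from this[of "(b - 1) div 2"] have "coeff G 1 \<noteq> 0" "1 \<le> degree (coeff G 1)"
    using assms(5,6) by (auto elim!: oddE)
  then have "degree (pderiv q * coeff G 1) \<noteq> 0"
    using q by (simp add: degree_mult_eq)
  then show False unfolding q1 by simp
qed

lemma bracket_zero_y_monic:
  fixes F G :: "'a::field_char_0 poly poly"
  assumes F: "y_monic F 2" and G: "y_monic G b" and b: "odd b" "b \<ge> 3"
    and bracket: "jacobian_bracket F G = [:[:c:]:]"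
  shows "c = 0"
proof -
  obtain f where f: "f \<noteq> 0" "coeff F 2 = [:f:]" using y_monicD[OF F] by blast
  obtain g where g: "g \<noteq> 0" "coeff G b = [:g:]" using y_monicD[OF G] by blast
  define f0 f1 where "f0 = coeff F 0" and "f1 = coeff F 1"
  have F_eq: "F = [:f0, f1, [:f:]:]"
  proof (rule poly_eqI)
    fix n :: nat
    consider "n = 0" | "n = 1" | "n = 2" | "n > 2" by linarith
    then show "coeff F n = coeff [:f0, f1, [:f:]:] n"
      using f(2) y_monicD(1)[OF F]
      by cases (auto simp: f0_def f1_def coeff_eq_0 coeff_pCons numeral_2_eq_2 split: nat.splits)
  qed
  \<comment> \<open>Completing the square: y -> y + u turns the linear coefficient into f1 + 2 f u =
    0.\<close>
  define u where "u = smult (- 1 / (2 * f)) f1"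
  have u: "f1 + smult (2 * f) u = 0" using f(1) by (simp add: u_def)
  have "pcompose F [:u, 1:] = [:f0 + u * (f1 + smult f u), f1 + smult (2 * f) u, [:f:]:]"
    unfolding F_eq by (simp add: pcompose_pCons algebra_simps flip: smult_add_left)
  then have F': "pcompose F [:u, 1:] = [:f0 + u * (f1 + smult f u), 0, [:f:]:]"
    unfolding u .
  have "degree (pcompose G [:u, 1:]) = b"
    using y_monicD(1)[OF G] by (simp add: degree_pcompose)
  moreover have "lead_coeff (pcompose G [:u, 1:]) = lead_coeff G * lead_coeff [:u, 1:] ^ degree G"
    by (rule lead_coeff_comp) simp
  ultimately have "coeff (pcompose G [:u, 1:]) b = [:g:]"
    using g y_monicD(1)[OF G] by simp
  moreover have "jacobian_bracket (pcompose F [:u, 1:]) (pcompose G [:u, 1:]) = [:[:c:]:]"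
    unfolding bracket_shift bracket by simp
  ultimately show "c = 0"
    unfolding F' using bracket_zero_completed_square f(1) g(1) b \<open>degree (pcompose G [:u, 1:]) = b\<close> by blast
qed

section \<open>Exchanging the two variables\<close>

definition swap_vars :: "'a::comm_monoid_add poly poly \<Rightarrow> 'a poly poly" where
  "swap_vars f = (\<Sum>j\<le>degree f. map_poly (\<lambda>c. monom c j) (coeff f j))"

lemma bicoeff_swap: "bicoeff (swap_vars f) i j = bicoeff f j i"
proof -
  have "bicoeff (swap_vars f) i j = (\<Sum>k\<le>degree f. if i = k then bicoeff f j k else 0)"
    unfolding swap_vars_def bicoeff_def by (auto simp: coeff_sum coeff_map_poly intro!: sum.cong)
  also have "\<dots> = bicoeff f j i"
    by (simp add: bicoeff_def coeff_eq_0)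
  finally show ?thesis .
qed

lemma bicoeff_eqI: "(\<And>i j. bicoeff f i j = bicoeff g i j) \<Longrightarrow> f = g"
  by (intro poly_eqI) (simp add: bicoeff_def)

lemma swap_vars_mult: "swap_vars (f * g) = swap_vars f * swap_vars g"
  for f g :: "'a::comm_semiring_0 poly poly"
proof (rule bicoeff_eqI)
  fix i j
  show "bicoeff (swap_vars (f * g)) i j = bicoeff (swap_vars f * swap_vars g) i j"
    unfolding bicoeff_mult bicoeff_swap
    by (rule sum.reindex_bij_witness[where i = prod.swap and j = prod.swap]) auto
qed

lemma swap_vars_diff: "swap_vars (f - g) = swap_vars f - swap_vars g"
  for f g :: "'a::ab_group_add poly poly"
proof (rule bicoeff_eqI)
  fix i j
  have *: "bicoeff (p - q) i j = bicoeff p i j - bicoeff q i j" for p q :: "'a poly poly" and i j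
    by (simp add: bicoeff_def)
  show "bicoeff (swap_vars (f - g)) i j = bicoeff (swap_vars f - swap_vars g) i j"
    by (simp only: * bicoeff_swap)
qed

lemma pderiv_x_swap: "pderiv_x (swap_vars f) = swap_vars (pderiv_y f)"
  and pderiv_y_swap: "pderiv_y (swap_vars f) = swap_vars (pderiv_x f)"
  for f :: "'a::field poly poly"
proof -
  have *: "bicoeff (pderiv_x h) i j = of_nat (Suc i) * bicoeff h (Suc i) j"
    "bicoeff (pderiv_y h) i j = of_nat (Suc j) * bicoeff h i (Suc j)" for h :: "'a poly poly" and i j
    by (simp_all add: bicoeff_def pderiv_x_def pderiv_y_def coeff_map_poly coeff_pderiv of_nat_poly del: of_nat_Suc)
  show "pderiv_x (swap_vars f) = swap_vars (pderiv_y f)" "pderiv_y (swap_vars f) = swap_vars (pderiv_x f)"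
    by (rule bicoeff_eqI, simp only: * bicoeff_swap)+
qed

text \<open>The exchange of variables has Jacobian determinant -1.\<close>

lemma bracket_swap: "jacobian_bracket (swap_vars f) (swap_vars g) = - swap_vars (jacobian_bracket f g)"
  for f g :: "'a::field poly poly"
  unfolding jacobian_bracket_def pderiv_x_swap pderiv_y_swap swap_vars_diff swap_vars_mult
  by (simp add: mult.commute)

lemma swap_vars_const: "swap_vars [:[:c:]:] = [:[:c:]:]"
proof (rule bicoeff_eqI)
  fix i j
  show "bicoeff (swap_vars [:[:c:]:]) i j = bicoeff [:[:c:]:] i j"
    unfolding bicoeff_swap by (auto simp: bicoeff_def coeff_pCons split: nat.splits)
qed

section \<open>The edge met by the diagonal\<close>

text \<open>The last point (l, l) of P on the diagonal is not interior, so it lies on a facet, which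
  in the plane is an edge cut out by a supporting line.\<close>

lemma exit_edge:
  fixes P :: "(real \<times> real) set"
  assumes "polytope P" "(0, 0) \<in> P" "(x, 0) \<in> P" "(0, y) \<in> P" "x > 0" "y > 0"
  obtains E a1 a2 \<beta> l where "E edge_of P" "E = {p \<in> P. a1 * fst p + a2 * snd p = \<beta>}"
    "\<And>p. p \<in> P \<Longrightarrow> a1 * fst p + a2 * snd p \<le> \<beta>" "\<beta> > 0" "l > 0" "(l, l) \<in> E"
proof -
  have cl: "compact P" "convex P" "polyhedron P"
    using assms(1) polytope_imp_compact polytope_imp_convex polytope_imp_polyhedron by auto
  let ?K = "P \<inter> {p. fst p = snd p}"
  have "closed {p :: real \<times> real. fst p = snd p}"
    by (intro closed_Collect_eq continuous_intros)
  with cl(1) have "compact ?K" by (rule compact_Int_closed)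
  moreover have "?K \<noteq> {}" using assms(2) by auto
  moreover have "continuous_on ?K (fst :: real \<times> real \<Rightarrow> real)" by (intro continuous_intros)
  ultimately have "\<exists>z\<in>?K. \<forall>p\<in>?K. fst p \<le> fst z" by (rule continuous_attains_sup)
  then obtain z where z: "z \<in> ?K" "\<And>p. p \<in> ?K \<Longrightarrow> fst p \<le> fst z" by blast
  define l where "l = fst z"
  have zl: "z = (l, l)" using z(1) by (auto simp: l_def prod_eq_iff)
  \<comment> \<open>The diagonal meets the segment from (x, 0) to (0, y) in (t, t), so l >= t >
    0.\<close>
  define t where "t = x * y / (x + y)"
  have "(y / (x + y)) *\<^sub>R (x, 0) + (x / (x + y)) *\<^sub>R (0, y) \<in> P"
    using cl(2) assms(3-6) by (intro convexD) (auto simp: add.commute simp flip: add_divide_distrib)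
  then have "(t, t) \<in> P" by (simp add: t_def mult.commute)
  then have "t \<le> l" using z(2)[of "(t, t)"] by (simp add: l_def)
  moreover have "t > 0" using assms by (simp add: t_def)
  ultimately have l: "l > 0" by simp
  have "span P = UNIV"
  proof -
    have "(1 / x) *\<^sub>R (x, 0) \<in> span P" "(1 / y) *\<^sub>R (0, y) \<in> span P"
      by (intro span_scale span_base; fact)+
    then have "(1, 0) \<in> span P" "(0, 1) \<in> span P" using assms by simp_all
    then have "u *\<^sub>R (1, 0) + v *\<^sub>R (0, 1) \<in> span P" for u v
      by (intro span_add span_scale)
    then show ?thesis by auto
  qed
  moreover have "0 \<in> affine hull P"
    using assms(2) by (metis hull_inc zero_prod_def)
  ultimately have aff: "affine hull P = UNIV"
    using affine_hull_span_0 by blast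
  have "z \<notin> interior P"
  proof
    assume "z \<in> interior P"
    then obtain \<epsilon> where \<epsilon>: "\<epsilon> > 0" "ball z \<epsilon> \<subseteq> P" by (auto simp: mem_interior)
    have "dist z (l + \<epsilon> / 4, l + \<epsilon> / 4) \<le> norm (\<epsilon> / 4) + norm (\<epsilon> / 4)"
      using norm_Pair_le[of "- \<epsilon> / 4" "- \<epsilon> / 4"] by (simp add: zl dist_norm)
    then have "(l + \<epsilon> / 4, l + \<epsilon> / 4) \<in> ball z \<epsilon>" using \<epsilon>(1) by simp
    then have "(l + \<epsilon> / 4, l + \<epsilon> / 4) \<in> ?K" using \<epsilon>(2) by auto
    from z(2)[OF this] show False using \<epsilon>(1) by (simp add: l_def)
  qed
  then have "z \<in> rel_frontier P"
    using z(1) closure_subset unfolding rel_frontier_frontier[OF aff] frontier_def by blast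
  then obtain E where E: "E facet_of P" "z \<in> E"
    using rel_frontier_of_polyhedron[OF cl(3)] by blast
  have dim: "aff_dim P = 2" using aff aff_dim_eq_full[of P] by simp
  have "E face_of P" "aff_dim E = 1" using E(1) dim by (auto simp: facet_of_def)
  then have edge: "E edge_of P" by (simp add: edge_of_def)
  from \<open>E face_of P\<close> have "E exposed_face_of P"
    using exposed_face_of_polyhedron[OF cl(3)] by simp
  then obtain a \<beta> where a: "P \<subseteq> {p. a \<bullet> p \<le> \<beta>}" "E = P \<inter> {p. a \<bullet> p = \<beta>}"
    unfolding exposed_face_of_def by blast
  obtain a1 a2 where a12: "a = (a1, a2)" by force
  have le: "a1 * fst p + a2 * snd p \<le> \<beta>" if "p \<in> P" for p
    using a(1) that by (cases p) (auto simp: a12)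
  have E_eq: "E = {p \<in> P. a1 * fst p + a2 * snd p = \<beta>}"
    unfolding a(2) a12 by (auto simp: inner_Pair)
  \<comment> \<open>For \<beta> = 0 the functional would be at most 0 at (x, 0) and (0, y) and
    vanish at (l, l). It would then be zero and E all of P, which has dimension 2.\<close>
  have "\<beta> > 0"
  proof (rule ccontr)
    assume "\<not> \<beta> > 0"
    then have "\<beta> = 0" using le[OF assms(2)] by simp
    then have "a1 * x \<le> 0" "a2 * y \<le> 0" "a1 * l + a2 * l = 0"
      using le[OF assms(3)] le[OF assms(4)] E(2) unfolding E_eq zl by auto
    then have "a1 \<le> 0" "a2 \<le> 0" "a1 + a2 = 0"
      using assms(5,6) l by (auto simp: mult_le_0_iff simp flip: distrib_right)
    then have "a1 = 0" "a2 = 0" by auto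
    then have "E = P" unfolding E_eq using \<open>\<beta> = 0\<close> by auto
    then show False using dim \<open>aff_dim E = 1\<close> by simp
  qed
  then show thesis
    using that edge E_eq le l E(2) zl by blast
qed

text \<open>Both functionals are constant along w - v, hence proportional, with values \<beta> and
  det(v, w) on the line. This converts the supporting functional into the weight.\<close>

lemma line_functional:
  fixes x y :: real
  assumes "a1 * v1 + a2 * v2 = \<beta>" "a1 * w1 + a2 * w2 = \<beta>"
  shows "\<beta> * (x * (w2 - v2) - y * (w1 - v1)) = (v1 * w2 - v2 * w1) * (a1 * x + a2 * y)"
proof -
  have "\<beta> * (x * (w2 - v2) - y * (w1 - v1)) = x * (\<beta> * w2 - \<beta> * v2) - y * (\<beta> * w1 - \<beta> * v1)"
    by (simp add: algebra_simps)
  also have "\<dots> = x * ((a1 * v1 + a2 * v2) * w2 - (a1 * w1 + a2 * w2) * v2)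
      - y * ((a1 * v1 + a2 * v2) * w1 - (a1 * w1 + a2 * w2) * v1)"
    by (simp only: assms)
  finally show ?thesis by (simp add: algebra_simps)
qed

text \<open>These are the determinants of (l, l) = v + s (w - v) with v and with w; their signs
  place v and w on the two sides of the diagonal.\<close>

lemma diagonal_point_on_line:
  fixes l :: real
  assumes "l = v1 + s * (w1 - v1)" "l = v2 + s * (w2 - v2)"
  shows "l * (v1 - v2) = s * (v1 * w2 - v2 * w1)" "l * (w2 - w1) = (1 - s) * (v1 * w2 - v2 * w1)"
proof -
  have "l * (v1 - v2) = l * v1 - l * v2" "l * (w2 - w1) = l * w2 - l * w1"
    by (simp_all add: algebra_simps)
  moreover have "l * v1 = (v2 + s * (w2 - v2)) * v1" "l * w1 = (v2 + s * (w2 - v2)) * w1"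
    using assms(2) by simp_all
  moreover have "l * v2 = (v1 + s * (w1 - v1)) * v2" "l * w2 = (v1 + s * (w1 - v1)) * w2"
    using assms(1) by simp_all
  ultimately have "l * (v1 - v2) = (v2 + s * (w2 - v2)) * v1 - (v1 + s * (w1 - v1)) * v2"
    "l * (w2 - w1) = (v1 + s * (w1 - v1)) * w2 - (v2 + s * (w2 - v2)) * w1"
    by (simp_all only:)
  then show "l * (v1 - v2) = s * (v1 * w2 - v2 * w1)" "l * (w2 - w1) = (1 - s) * (v1 * w2 - v2 * w1)"
    by (simp_all add: algebra_simps)
qed

lemma lattice_exit_edge:
  fixes P :: "(real \<times> real) set"
  assumes P: "polytope P" "(0, 0) \<in> P" "(x, 0) \<in> P" "(0, y) \<in> P" "x > 0" "y > 0"
    and lattice: "\<And>p. p extreme_point_of P \<Longrightarrow> p \<in> lattice_points"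
    and edges: "\<And>E. E edge_of P \<Longrightarrow> (0, 0) \<in> E \<or> (\<forall>p \<in> E \<inter> lattice_points. p extreme_point_of E)"
  obtains v1 v2 w1 w2 :: int where
    "(of_int v1, of_int v2) extreme_point_of P" "(of_int w1, of_int w2) extreme_point_of P"
    "coprime (w1 - v1) (w2 - v2)" "v1 * w2 - v2 * w1 > 0" "v2 \<le> v1" "w1 \<le> w2"
    "\<And>p. p \<in> P \<Longrightarrow> fst p * of_int (w2 - v2) - snd p * of_int (w1 - v1) \<le> of_int (v1 * w2 - v2 * w1)"
    "\<And>p. p \<in> P \<Longrightarrow> fst p * of_int (w2 - v2) - snd p * of_int (w1 - v1) = of_int (v1 * w2 - v2 * w1) \<Longrightarrow>
       \<exists>s\<in>{0..1}. p = (of_int v1 + s * of_int (w1 - v1), of_int v2 + s * of_int (w2 - v2))"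
proof -
  obtain E a1 a2 \<beta> l where E: "E edge_of P" "E = {p \<in> P. a1 * fst p + a2 * snd p = \<beta>}"
    and le: "\<And>p. p \<in> P \<Longrightarrow> a1 * fst p + a2 * snd p \<le> \<beta>" and \<beta>: "\<beta> > 0" and l: "l > 0" "(l, l) \<in> E"
    using exit_edge[OF P] by blast
  have face: "E face_of P" and dim: "aff_dim E = 1" using E(1) by (auto simp: edge_of_def)
  then have "polytope E" using P(1) face_of_polytope_polytope by blast
  then have "E \<noteq> {}" "compact E" "convex E" "collinear E"
    using dim l polytope_imp_compact polytope_imp_convex by (auto simp: collinear_aff_dim)
  then obtain v' w' where vw': "E = closed_segment v' w'"
    by (rule compact_convex_collinear_segment)
  have "v' extreme_point_of E" "w' extreme_point_of E"
    unfolding vw' by (simp_all add: extreme_point_of_segment)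
  then have ext: "v' extreme_point_of P" "w' extreme_point_of P"
    using extreme_point_of_face[OF face] by auto
  have v'w': "v' \<noteq> w'" using dim vw' by auto
  have on_line: "a1 * fst v' + a2 * snd v' = \<beta>" "a1 * fst w' + a2 * snd w' = \<beta>"
    using E(2) vw' by auto
  \<comment> \<open>The line of E misses the origin since \<beta> > 0, so distinct points on it are
    linearly independent.\<close>
  have "fst v' * snd w' - snd v' * fst w' \<noteq> 0"
  proof
    assume *: "fst v' * snd w' - snd v' * fst w' = 0"
    have "\<beta> * fst w' = \<beta> * fst v'" "\<beta> * snd w' = \<beta> * snd v'"
      using * on_line by algebra+
    then show False using \<beta> v'w' by (auto simp: prod_eq_iff)
  qed
  \<comment> \<open>The endpoints are named so that det(v, w) > 0.\<close>
  then consider "fst v' * snd w' - snd v' * fst w' > 0" | "fst w' * snd v' - snd w' * fst v' > 0"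
    by (fastforce simp: mult.commute neq_iff)
  then obtain v w where vw: "E = closed_segment v w" "fst v * snd w - snd v * fst w > 0"
    "v extreme_point_of P" "w extreme_point_of P"
    "a1 * fst v + a2 * snd v = \<beta>" "a1 * fst w + a2 * snd w = \<beta>"
  proof cases
    case 1
    then show thesis using that[of v' w'] vw' ext on_line by blast
  next
    case 2
    then show thesis using that[of w' v'] vw' ext on_line closed_segment_commute[of v' w'] by blast
  qed
  obtain v1 v2 where v: "v = (of_int v1, of_int v2)"
    using lattice[OF vw(3)] unfolding lattice_points_def by (auto elim!: Ints_cases)
  obtain w1 w2 where w: "w = (of_int w1, of_int w2)"
    using lattice[OF vw(4)] unfolding lattice_points_def by (auto elim!: Ints_cases)
  define m1 m2 D where "m1 = w1 - v1" and "m2 = w2 - v2" and "D = v1 * w2 - v2 * w1"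
  have "real_of_int D > 0" using vw(2) by (simp add: v w D_def)
  then have D: "D > 0" by simp
  have D': "real_of_int D = of_int v1 * of_int w2 - of_int v2 * of_int w1"
    by (simp add: D_def)
  have segment: "\<exists>s\<in>{0..1}. p = (of_int v1 + s * of_int m1, of_int v2 + s * of_int m2)" if p: "p \<in> E" for p
  proof -
    obtain s where s: "0 \<le> s" "s \<le> 1" "p = (1 - s) *\<^sub>R v + s *\<^sub>R w"
      using p unfolding vw(1) in_segment by blast
    then have "p = (of_int v1 + s * of_int m1, of_int v2 + s * of_int m2)"
      by (simp add: v w m1_def m2_def algebra_simps)
    then show ?thesis using s by auto
  qed
  have functional: "\<beta> * (fst p * of_int m2 - snd p * of_int m1) = of_int D * (a1 * fst p + a2 * snd p)" for p :: "real \<times> real"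
    using line_functional[OF vw(5,6)] by (simp add: D' m1_def m2_def v w)
  have below: "fst p * of_int m2 - snd p * of_int m1 \<le> of_int D" if "p \<in> P" for p
  proof -
    have "\<beta> * (fst p * of_int m2 - snd p * of_int m1) \<le> \<beta> * of_int D"
      unfolding functional using le[OF that] D by (simp add: mult.commute)
    then show ?thesis using \<beta> by simp
  qed
  have on_edge: "p \<in> E" if "p \<in> P" "fst p * of_int m2 - snd p * of_int m1 = of_int D" for p
  proof -
    have "of_int D * (a1 * fst p + a2 * snd p) = of_int D * \<beta>"
      unfolding functional[symmetric] that(2) by simp
    then show ?thesis using D that(1) unfolding E(2) by simp
  qed
  obtain s where s: "0 \<le> s" "s \<le> 1" "l = of_int v1 + s * of_int m1" "l = of_int v2 + s * of_int m2"
    using segment[OF l(2)] by auto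
  have diagonal: "l * of_int (v1 - v2) = s * of_int D" "l * of_int (w2 - w1) = (1 - s) * of_int D"
    using diagonal_point_on_line[OF s(3,4)[unfolded m1_def m2_def of_int_diff]] by (simp_all add: D')
  then have "0 \<le> l * of_int (v1 - v2)" unfolding diagonal using s D by simp
  then have cone1: "v2 \<le> v1" using l(1) by (simp add: zero_le_mult_iff)
  have "0 \<le> l * of_int (w2 - w1)" unfolding diagonal using s D by simp
  then have cone2: "w1 \<le> w2" using l(1) by (simp add: zero_le_mult_iff)
  \<comment> \<open>With g the gcd, v + m/g is a lattice point of E. As E misses the origin, this
    point is an endpoint; it differs from v, so it is w and g = 1.\<close>
  have "coprime m1 m2"
  proof -
    define g where "g = gcd m1 m2"
    have m: "m1 \<noteq> 0 \<or> m2 \<noteq> 0" using v'w' vw' vw(1) D by (auto simp: m1_def m2_def D_def)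
    then have "g > 0" by (simp add: g_def)
    obtain n1 n2 where n: "m1 = g * n1" "m2 = g * n2"
      unfolding g_def by (metis dvdE gcd_dvd1 gcd_dvd2)
    define p :: "real \<times> real" where "p = (of_int (v1 + n1), of_int (v2 + n2))"
    have "p = (1 - 1 / of_int g) *\<^sub>R v + (1 / of_int g) *\<^sub>R w"
    proof -
      have "of_int w1 = (of_int v1 + of_int g * of_int n1 :: real)"
        "of_int w2 = (of_int v2 + of_int g * of_int n2 :: real)"
        using n unfolding m1_def m2_def by (simp_all flip: of_int_mult of_int_add)
      then show ?thesis using \<open>g > 0\<close> by (simp add: p_def v w field_simps)
    qed
    moreover have "0 \<le> 1 / real_of_int g" "1 / real_of_int g \<le> 1" using \<open>g > 0\<close> by auto
    ultimately have "p \<in> E" unfolding vw(1) in_segment by blast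
    moreover have "p \<in> lattice_points" by (simp add: p_def lattice_points_def)
    moreover have "(0, 0) \<notin> E" using \<beta> by (simp add: E(2))
    ultimately have "p extreme_point_of E" using edges[OF E(1)] by blast
    then have "p = v \<or> p = w" unfolding vw(1) by (simp add: extreme_point_of_segment)
    then have "(n1 = 0 \<and> n2 = 0) \<or> (n1 = m1 \<and> n2 = m2)"
      by (auto simp: p_def v w m1_def m2_def simp flip: of_int_add)
    then have "g = 1" using n m by auto
    then show ?thesis by (simp add: g_def coprime_iff_gcd_eq_1)
  qed
  then show thesis
    using that[of v1 v2 w1 w2] vw(3,4) v w D cone1 cone2 below segment on_edge
    unfolding m1_def m2_def D_def by blast
qed

section \<open>From the scaled Newton polygon to edge polynomials\<close>

lemma scale_set_newton_polygon:
  "scale_set r (newton_polygon f) = convex hull ((\<lambda>(i, j). (r * real i, r * real j)) ` supp f)"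
proof -
  have "(\<lambda>s. r *\<^sub>R s) ` (\<lambda>(i, j). (real i, real j)) ` supp f = (\<lambda>(i, j). (r * real i, r * real j)) ` supp f"
    unfolding image_image by (intro image_cong) auto
  then show ?thesis
    unfolding scale_set_def newton_polygon_def convex_hull_scaling[symmetric] by simp
qed

lemma scale_set_scale_set: "scale_set r (scale_set s S) = scale_set (r * s) S"
  by (simp add: scale_set_def image_image)

lemma extreme_point_scaled_newton_polygon:
  assumes "p extreme_point_of scale_set r (newton_polygon f)"
  obtains i j where "(i, j) \<in> supp f" "p = (r * real i, r * real j)"
  using extreme_point_of_convex_hull[OF assms[unfolded scale_set_newton_polygon]] by auto

text \<open>Extreme points of a convex hull belong to the generating set, here the scaled
  support.\<close>

lemma extreme_lattice_point_icoeff: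
  assumes "(of_int x, of_int y) extreme_point_of scale_set (1 / real a) (newton_polygon f)" "a > 0"
  shows "icoeff f (int a * x) (int a * y) \<noteq> 0"
proof -
  obtain i j where ij: "(i, j) \<in> supp f" "(of_int x, of_int y) = (1 / real a * real i, 1 / real a * real j)"
    using extreme_point_scaled_newton_polygon[OF assms(1)] .
  then have "real_of_int (int i) = of_int (int a * x)" "real_of_int (int j) = of_int (int a * y)"
    using assms(2) by (simp_all add: field_simps)
  then have "int i = int a * x" "int j = int a * y" by (simp_all only: of_int_eq_iff)
  moreover have "icoeff f (int i) (int j) \<noteq> 0" using ij(1) by (simp add: supp_def)
  ultimately show ?thesis by simp
qed

text \<open>A scaled support point of top weight is v + s m with s in [0, 1]; the unscaled point
  then has index a s, an integer between 0 and a. The vertex v + m contributes the index a.\<close>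

lemma (in edge_direction) polygon_edge:
  fixes f :: "'a::zero poly poly" and a :: nat
  defines "P \<equiv> scale_set (1 / real a) (newton_polygon f)"
  assumes "a > 0"
    and below: "\<And>p. p \<in> P \<Longrightarrow> fst p * of_int m2 - snd p * of_int m1 \<le> of_int (wt v1 v2)"
    and on: "\<And>p. p \<in> P \<Longrightarrow> fst p * of_int m2 - snd p * of_int m1 = of_int (wt v1 v2) \<Longrightarrow>
       \<exists>s\<in>{0..1}. p = (of_int v1 + s * of_int m1, of_int v2 + s * of_int m2)"
    and ext: "(of_int (v1 + m1), of_int (v2 + m2)) extreme_point_of P"
  shows "starts_at f (int a * v1) (int a * v2)" "degree (edge_poly f (int a * v1) (int a * v2)) = a"
proof -
  let ?r = "int a * v1" and ?s = "int a * v2"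
  have edge: "wt i j < wt ?r ?s \<or> (\<exists>n\<le>a. i = ?r + int n * m1 \<and> j = ?s + int n * m2)"
    if ij: "icoeff f i j \<noteq> 0" for i j
  proof -
    note nonneg = icoeff_nonzeroD[OF ij]
    define p where "p = (1 / real a * of_int i, 1 / real a * of_int j)"
    have "p \<in> P"
      unfolding P_def scale_set_newton_polygon
      using nonneg by (intro hull_inc image_eqI[of _ _ "(nat i, nat j)"]) (auto simp: p_def)
    have wt_p: "real_of_int (wt i j) = real a * (fst p * of_int m2 - snd p * of_int m1)"
      using assms(2) by (simp add: p_def wt_def field_simps)
    show ?thesis
    proof (cases "fst p * of_int m2 - snd p * of_int m1 = of_int (wt v1 v2)")
      case True
      then obtain s where s: "0 \<le> s" "s \<le> 1" "p = (of_int v1 + s * of_int m1, of_int v2 + s * of_int m2)"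
        using on[OF \<open>p \<in> P\<close>] by auto
      have "real_of_int (wt i j) = of_int (wt ?r ?s)"
        unfolding wt_p True wt_scale by simp
      then have "wt i j = wt ?r ?s" by (simp only: of_int_eq_iff)
      then obtain k where k: "i = ?r + k * m1" "j = ?s + k * m2" by (rule collinear_imp_shift)
      have "of_int i = real a * fst p" "of_int j = real a * snd p"
        using assms(2) by (simp_all add: p_def)
      then have "of_int k * real_of_int m1 = (real a * s) * of_int m1"
        "of_int k * real_of_int m2 = (real a * s) * of_int m2"
        unfolding s(3) k by (simp_all add: algebra_simps)
      then have "of_int k = real a * s" using nonzero by auto
      moreover have "0 \<le> real a * s" "real a * s \<le> real a * 1"
        using s assms(2) by (simp_all add: mult_left_le)
      ultimately have "0 \<le> real_of_int k" "real_of_int k \<le> of_int (int a)" by simp_all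
      then have "0 \<le> k" "k \<le> int a" by (simp_all only: of_int_0_le_iff of_int_le_iff)
      then show ?thesis using k by (intro disjI2 exI[of _ "nat k"]) auto
    next
      case False
      then have "real a * (fst p * of_int m2 - snd p * of_int m1) < real a * of_int (wt v1 v2)"
        using below[OF \<open>p \<in> P\<close>] assms(2) by (intro mult_strict_left_mono) auto
      then have "real_of_int (wt i j) < of_int (wt ?r ?s)"
        unfolding wt_p wt_scale by simp
      then show ?thesis by (simp only: of_int_less_iff simp_thms)
    qed
  qed
  show "starts_at f ?r ?s" using edge unfolding starts_at_def by blast
  have "coeff (edge_poly f ?r ?s) n = 0" if "n > a" for n
  proof (rule ccontr)
    assume "coeff (edge_poly f ?r ?s) n \<noteq> 0"
    from edge[OF this[unfolded coeff_edge_poly]]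
    obtain k where "k \<le> a" "?r + int n * m1 = ?r + int k * m1 \<and> ?s + int n * m2 = ?s + int k * m2"
      by auto
    then show False using that unfolding shift_eq_iff by simp
  qed
  then have "degree (edge_poly f ?r ?s) \<le> a" by (intro degree_le) auto
  moreover have "coeff (edge_poly f ?r ?s) a \<noteq> 0"
    using extreme_lattice_point_icoeff[OF ext[unfolded P_def] assms(2)]
    by (simp add: coeff_edge_poly algebra_simps)
  ultimately show "degree (edge_poly f ?r ?s) = a"
    using le_degree by (intro antisym)
qed

section \<open>The exceptional triangle and the conclusion\<close>

lemma y_monicI:
  assumes "k > 0" "\<And>i j. bicoeff f i j \<noteq> 0 \<Longrightarrow> int i + int j * k \<le> int n * k" "bicoeff f 0 n \<noteq> 0"
  shows "y_monic f n"
  unfolding y_monic_def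
proof (intro conjI allI impI)
  fix i j assume "bicoeff f i j \<noteq> 0"
  from assms(2)[OF this] have le: "int i + int j * k \<le> int n * k" .
  show "j < n \<or> (j = n \<and> i = 0)"
  proof (cases "j < n")
    case False
    then have "int n * k \<le> int j * k" using assms(1) by (intro mult_right_mono) auto
    with le have "i = 0" "int j * k \<le> int n * k" by auto
    then show ?thesis using assms(1) False by auto
  qed simp
qed (fact assms(3))

text \<open>By \<open>gt\<close>, (1, 1) lies beyond the line through v and w. With e = v1 - v2 and
  e' = w2 - w1 this reads e + e' > v2 e' + e w1 + e e'. Together with det(v, w) > 0 it forces v2 =
  w1 = 0, and then (v1 - 1) (w2 - 1) < 1.\<close>

lemma diagonal_outside_triangle:
  fixes v1 v2 w1 w2 :: int
  assumes "0 \<le> v2" "v2 \<le> v1" "0 \<le> w1" "w1 \<le> w2" "0 < v1 * w2 - v2 * w1"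
    and gt: "(w2 - v2) - (w1 - v1) > v1 * w2 - v2 * w1"
  shows "v2 = 0" "w1 = 0" "v1 = 1 \<or> w2 = 1"
proof -
  define e e' where "e = v1 - v2" and "e' = w2 - w1"
  have e: "0 \<le> e" "0 \<le> e'" using assms by (simp_all add: e_def e'_def)
  have D: "v1 * w2 - v2 * w1 = v2 * e' + e * w1 + e * e'"
    by (simp add: e_def e'_def algebra_simps)
  have gt': "e + e' > v2 * e' + e * w1 + e * e'"
    using gt unfolding D by (simp add: e_def e'_def)
  show v2: "v2 = 0"
  proof (rule ccontr)
    assume "v2 \<noteq> 0"
    then have "1 * e' \<le> v2 * e'" using assms e by (intro mult_right_mono) auto
    then have "e > e * (w1 + e')" using gt' by (simp add: algebra_simps)
    then have "w1 + e' < 1" using e by (metis mult.right_neutral mult_left_mono not_less)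
    then have "w2 = 0" "w1 = 0" using assms e by (auto simp: e'_def)
    then show False using assms(5) by simp
  qed
  show w1: "w1 = 0"
  proof (rule ccontr)
    assume "w1 \<noteq> 0"
    then have "e * 1 \<le> e * w1" using assms e by (intro mult_left_mono) auto
    then have "e' > e' * e" using gt' v2 by (simp add: algebra_simps)
    then have "e < 1" using e by (metis mult.right_neutral mult_left_mono not_less)
    then have "v1 = 0" using e v2 by (simp add: e_def)
    then show False using assms(5) v2 by simp
  qed
  have pos: "v1 > 0" "w2 > 0"
    using assms(2,4,5) v2 w1 by (auto simp: zero_less_mult_iff)
  show "v1 = 1 \<or> w2 = 1"
  proof (rule ccontr)
    assume "\<not> ?thesis"
    then have "0 < (v1 - 1) * (w2 - 1)" using pos by simp
    then show False using gt v2 w1 by (simp add: algebra_simps)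
  qed
qed

theorem corollary1p4:
  fixes F G :: "'k::{alg_closed_field, field_char_0} poly poly"
    and a b :: nat
  assumes "a = 2" and "b \<ge> 2" and "coprime b a"
    and "\<exists>c. jacobian_bracket F G = [:[:c:]:]"
    and "{(1, 0), (0, 1), (0, 0)} \<subseteq> newton_polygon F \<inter> newton_polygon G"
    and "real (total_degree F) / real (total_degree G) = real a / real b"
    and "newton_polygon F = scale_set (real a / real b) (newton_polygon G)"
    and "\<And>E. E edge_of scale_set (1 / real a) (newton_polygon F) \<Longrightarrow>
           (0, 0) \<in> E \<or> (\<forall>p \<in> E \<inter> lattice_points. p extreme_point_of E)"
  shows "jacobian_bracket F G = 0"
proof -
  obtain c where c: "jacobian_bracket F G = [:[:c:]:]" using assms(4) by blast
  have b: "odd b" "b \<ge> 3"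
  proof -
    show "odd b" using assms(1,3) by simp
    then show "b \<ge> 3" using assms(2) by (cases "b = 2") auto
  qed
  define P where "P = scale_set (1 / 2) (newton_polygon F)"
  have P_F: "P = scale_set (1 / real 2) (newton_polygon F)" by (simp add: P_def)
  have P_G: "P = scale_set (1 / real b) (newton_polygon G)"
    using assms(1) unfolding P_def assms(7) scale_set_scale_set by simp
  have poly: "polytope P"
    unfolding P_def scale_set_newton_polygon polytope_def using finite_supp by blast
  have half: "(1 / 2) *\<^sub>R p \<in> P" if "p \<in> newton_polygon F" for p
    unfolding P_def scale_set_def using that by (rule imageI)
  have pts: "(0, 0) \<in> P" "(1 / 2, 0) \<in> P" "(0, 1 / 2) \<in> P"
    using assms(5) half[of "(0, 0)"] half[of "(1, 0)"] half[of "(0, 1)"] by simp_all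
  have lattice: "p \<in> lattice_points" if p: "p extreme_point_of P" for p
  proof -
    obtain i j where ij: "p = (1 / real 2 * real i, 1 / real 2 * real j)"
      using extreme_point_scaled_newton_polygon[OF p[unfolded P_F]] .
    obtain i' j' where ij': "p = (1 / real b * real i', 1 / real b * real j')"
      using extreme_point_scaled_newton_polygon[OF p[unfolded P_G]] .
    \<comment> \<open>For a coordinate x both 2 x and b x are integers; with b = 2 t + 1 so is x = b
      x - t (2 x).\<close>
    obtain t where t: "b = 2 * t + 1" using b(1) by (rule oddE)
    have *: "x = of_int (int k' - int t * int k)" if "x = 1 / real 2 * real k" "x = 1 / real b * real k'" for x k k'
    proof -
      have "real b * x = real k'" using that(2) b by simp
      then show ?thesis unfolding t using that(1) by (simp add: algebra_simps)
    qed
    have "fst p \<in> \<int>" "snd p \<in> \<int>"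
      using *[of "fst p" i i'] *[of "snd p" j j'] ij ij' by (metis Ints_of_int fst_conv snd_conv)+
    then show ?thesis by (cases p) (simp add: lattice_points_def)
  qed
  have edges: "(0, 0) \<in> E \<or> (\<forall>p \<in> E \<inter> lattice_points. p extreme_point_of E)" if "E edge_of P" for E
    using assms(8)[of E] that assms(1) by (simp add: P_def)
  obtain v1 v2 w1 w2 :: int where
    ext: "(of_int v1, of_int v2) extreme_point_of P" "(of_int w1, of_int w2) extreme_point_of P"
    and cop: "coprime (w1 - v1) (w2 - v2)" and D: "v1 * w2 - v2 * w1 > 0" and cone: "v2 \<le> v1" "w1 \<le> w2"
    and below: "\<And>p. p \<in> P \<Longrightarrow> fst p * of_int (w2 - v2) - snd p * of_int (w1 - v1) \<le> of_int (v1 * w2 - v2 * w1)"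
    and on: "\<And>p. p \<in> P \<Longrightarrow> fst p * of_int (w2 - v2) - snd p * of_int (w1 - v1) = of_int (v1 * w2 - v2 * w1) \<Longrightarrow>
       \<exists>s\<in>{0..1}. p = (of_int v1 + s * of_int (w1 - v1), of_int v2 + s * of_int (w2 - v2))"
  proof -
    show thesis
      by (rule lattice_exit_edge[OF poly pts half_gt_zero[OF zero_less_one] half_gt_zero[OF zero_less_one]
            lattice edges], assumption, assumption, rule that)
  qed
  interpret edge_direction "w1 - v1" "w2 - v2" using cop by unfold_locales
  have wt_v: "wt v1 v2 = v1 * w2 - v2 * w1" by (simp add: wt_def algebra_simps)
  have ext': "(of_int (v1 + (w1 - v1)), of_int (v2 + (w2 - v2))) extreme_point_of P" using ext(2) by simp
  have F: "starts_at F (2 * v1) (2 * v2)" "degree (edge_poly F (2 * v1) (2 * v2)) = 2"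
    using polygon_edge[of 2 F v1 v2] below on ext' unfolding P_F wt_v by auto
  have G: "starts_at G (int b * v1) (int b * v2)"
    using polygon_edge(1)[of b G v1 v2] below on ext' b unfolding P_G wt_v by auto
  have F_v: "icoeff F (2 * v1) (2 * v2) \<noteq> 0" and F_w: "icoeff F (2 * w1) (2 * w2) \<noteq> 0"
    using extreme_lattice_point_icoeff[of _ _ 2 F] ext unfolding P_F by auto
  have G_v: "icoeff G (int b * v1) (int b * v2) \<noteq> 0" and G_w: "icoeff G (int b * w1) (int b * w2) \<noteq> 0"
    using extreme_lattice_point_icoeff[of _ _ b G] ext b unfolding P_G by auto
  have "c = 0"
  \<comment> \<open>The weight of (1, 1) is compared with D: the edge equation settles the case in
    which (1, 1) is not beyond the edge.\<close>
  proof (cases "(w2 - v2) - (w1 - v1) \<le> v1 * w2 - v2 * w1")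
    case True
    then show ?thesis
      using bracket_zero_of_edge[OF F(1) G wt_v D _ b cone(1) _ F(2) F_v G_v c] cone(2) by simp
  next
    case False
    have "0 \<le> v2" "0 \<le> w1"
      using icoeff_nonzeroD(2)[OF F_v] icoeff_nonzeroD(1)[OF F_w] by simp_all
    then have tri: "v2 = 0" "w1 = 0" "v1 = 1 \<or> w2 = 1"
      using diagonal_outside_triangle[of v2 v1 w1 w2] False D cone by auto
    \<comment> \<open>Now v = (v1, 0) and w = (0, w2), so x has weight w2 and y has weight
      v1.\<close>
    have wt_eq: "wt i j = i * w2 + j * v1" for i j unfolding wt_def by (simp add: tri)
    have wt_le: "int i * w2 + int j * v1 \<le> int n * (v1 * w2)"
      if "starts_at f (int n * v1) (int n * v2)" "bicoeff f i j \<noteq> 0" for f :: "'k poly poly" and n i j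
    proof -
      have "icoeff f (int i) (int j) \<noteq> 0" using that(2) by simp
      then have "wt (int i) (int j) \<le> wt (int n * v1) (int n * v2)"
        using starts_at_imp_bounded[OF that(1)] unfolding bounded_by_def by blast
      then show ?thesis unfolding wt_eq by (simp add: tri)
    qed
    have "starts_at F (int 2 * v1) (int 2 * v2)" using F(1) by simp
    note F_le = wt_le[OF this] and G_le = wt_le[OF G]
    from tri(3) show ?thesis
    proof
      \<comment> \<open>The weight bounds i + j v1 <= 2 v1 for F and i + j v1 <= b v1 for G make
        both monic in y up to constants.\<close>
      assume "w2 = 1"
      then have "v1 > 0" using D tri by simp
      have "bicoeff F 0 2 \<noteq> 0" "bicoeff G 0 b \<noteq> 0"
        using F_w G_w tri \<open>w2 = 1\<close> by (simp_all add: icoeff_def)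
      then have "y_monic F 2" "y_monic G b"
        using F_le G_le \<open>w2 = 1\<close> \<open>v1 > 0\<close> by (auto intro!: y_monicI[of v1])
      then show "c = 0" using bracket_zero_y_monic b c by blast
    next
      \<comment> \<open>Here F is quadratic in x, so the variables are exchanged first.\<close>
      assume "v1 = 1"
      then have "w2 > 0" using D tri by simp
      have "bicoeff (swap_vars F) 0 2 \<noteq> 0" "bicoeff (swap_vars G) 0 b \<noteq> 0"
        using F_v G_v tri \<open>v1 = 1\<close> by (simp_all add: icoeff_def bicoeff_swap)
      then have "y_monic (swap_vars F) 2" "y_monic (swap_vars G) b"
        using F_le G_le \<open>v1 = 1\<close> \<open>w2 > 0\<close>
        by (auto intro!: y_monicI[of w2] simp: bicoeff_swap add.commute)
      moreover have "jacobian_bracket (swap_vars F) (swap_vars G) = [:[:- c:]:]"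
        unfolding bracket_swap c swap_vars_const by simp
      ultimately have "- c = 0" using bracket_zero_y_monic b by blast
      then show "c = 0" by simp
    qed
  qed
  then show ?thesis unfolding c by simp
qed

end
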